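(* Let $n\ge 1$ and $\epsilon\in(0,1]$. Consider the following testing problem: given access to independent copies of two unknown $n$-qubit mixed states $\rho$ and $\sigma$ (density matrices on $\mathbb{C}^{2^n}$), promised that either $\rho=\sigma$ or $\|\rho-\sigma\|_1>\epsilon$, decide which case holds, with success probability at least $2/3$ in each case. If each copy may only be measured individually by a two-outcome Pauli measurement, then the minimal total number of copies of $\rho$ and $\sigma$ needed is $\Theta\!\left(\mathrm{poly}(n)\cdot\frac{4^n}{\epsilon^2}\right)$. More precisely, there is a tester using $O\!\left(\frac{n^4\cdot 4^n}{\epsilon^2}\right)$ copies, and every such tester (even one that chooses its Pauli measurements adaptively) needs $\Omega\!\left(\frac{4^n}{\epsilon^2}\right)$ copies. *)

theory Defs
  imports "Jordan_Normal_Form.Char_Poly" "HOL-Computational_Algebra.Polynomial"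
begin

definition mtrace :: "complex mat \<Rightarrow> complex" where
  "mtrace A = (\<Sum>i<dim_row A. A $$ (i,i))"

definition adj :: "complex mat \<Rightarrow> complex mat" where
  "adj A = mat (dim_col A) (dim_row A) (\<lambda>(i,j). cnj (A $$ (j,i)))"

definition density_matrix :: "nat \<Rightarrow> complex mat \<Rightarrow> bool" where
  "density_matrix n \<rho> \<longleftrightarrow>
     \<rho> \<in> carrier_mat (2^n) (2^n) \<and> adj \<rho> = \<rho> \<and>
     (\<forall>v :: nat \<Rightarrow> complex.
        0 \<le> Re (\<Sum>i<2^n. \<Sum>j<2^n. cnj (v i) * \<rho> $$ (i,j) * v j)) \<and>
     mtrace \<rho> = 1"

text \<open>Trace norm (Schatten 1-norm): the sum of the singular values, i.e. of the square
  roots of the eigenvalues (with multiplicity) of A^* A.\<close>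
definition trace_norm :: "complex mat \<Rightarrow> real" where
  "trace_norm A = sum_mset (image_mset (\<lambda>z. sqrt (Re z)) (proots (char_poly (adj A * A))))"

text \<open>Single-qubit Paulis: 0 = I, 1 = X, 2 = Y, 3 = Z (entries indexed by bits a, b).\<close>
definition pauli1 :: "nat \<Rightarrow> nat \<Rightarrow> nat \<Rightarrow> complex" where
  "pauli1 p a b =
     (if p = 0 then (if a = b then 1 else 0)
      else if p = 1 then (if a \<noteq> b then 1 else 0)
      else if p = 2 then (if a = 0 \<and> b = 1 then - \<i> else if a = 1 \<and> b = 0 then \<i> else 0)
      else (if a = b then (if a = 0 then 1 else -1) else 0))"

text \<open>n-qubit Pauli strings and the corresponding tensor-product operators
  (qubit k corresponds to bit k of the basis index).\<close>
definition pauli_strings :: "nat \<Rightarrow> nat list set" where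
  "pauli_strings n = {s. length s = n \<and> set s \<subseteq> {0..<4}}"

definition pauli_mat :: "nat \<Rightarrow> nat list \<Rightarrow> complex mat" where
  "pauli_mat n s = mat (2^n) (2^n)
     (\<lambda>(i,j). \<Prod>k<n. pauli1 (s ! k) (i div 2^k mod 2) (j div 2^k mod 2))"

text \<open>Two-outcome Pauli measurement of P on state \<rho>: outcome True (+1) corresponds to
  the projector (I+P)/2, outcome False (-1) to (I-P)/2; Born rule probabilities.\<close>
definition pauli_outcome_prob :: "nat \<Rightarrow> complex mat \<Rightarrow> nat list \<Rightarrow> bool \<Rightarrow> real" where
  "pauli_outcome_prob n \<rho> s b =
     Re (mtrace (((1/2) \<cdot>\<^sub>m (if b then 1\<^sub>m (2^n) + pauli_mat n s else 1\<^sub>m (2^n) - pauli_mat n s)) * \<rho>))"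

text \<open>A query is (c, s): c = True means a fresh copy of \<rho>, c = False a fresh copy of \<sigma>,
  measured with the Pauli string s. A history is the list of (c, s, outcome).
  A tester consists of
  - a (randomized, adaptive) rule giving, for every history, a probability distribution
    over the next query, and
  - a (randomized) final rule giving, for every full history, the probability of
    answering "\<rho> = \<sigma>" (accept).\<close>
type_synonym history = "(bool \<times> nat list \<times> bool) list"
type_synonym tester = "(history \<Rightarrow> bool \<times> nat list \<Rightarrow> real) \<times> (history \<Rightarrow> real)"

definition queries :: "nat \<Rightarrow> (bool \<times> nat list) set" where
  "queries n = UNIV \<times> pauli_strings n"

definition valid_tester :: "nat \<Rightarrow> tester \<Rightarrow> bool" where
  "valid_tester n T \<longleftrightarrow>
     (\<forall>h. (\<forall>q\<in>queries n. 0 \<le> fst T h q) \<and> (\<Sum>q\<in>queries n. fst T h q) = 1) \<and>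
     (\<forall>h. 0 \<le> snd T h \<and> snd T h \<le> 1)"

fun accept_prob :: "nat \<Rightarrow> tester \<Rightarrow> complex mat \<Rightarrow> complex mat \<Rightarrow> nat \<Rightarrow> history \<Rightarrow> real" where
  "accept_prob n T \<rho> \<sigma> 0 h = snd T h"
| "accept_prob n T \<rho> \<sigma> (Suc k) h =
     (\<Sum>q\<in>queries n. fst T h q *
        (\<Sum>b\<in>(UNIV::bool set).
           pauli_outcome_prob n (if fst q then \<rho> else \<sigma>) (snd q) b *
           accept_prob n T \<rho> \<sigma> k (h @ [(fst q, snd q, b)])))"

definition pauli_closeness_tester :: "nat \<Rightarrow> real \<Rightarrow> nat \<Rightarrow> tester \<Rightarrow> bool" where
  "pauli_closeness_tester n \<epsilon> m T \<longleftrightarrow>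
     valid_tester n T \<and>
     (\<forall>\<rho> \<sigma>. density_matrix n \<rho> \<and> density_matrix n \<sigma> \<longrightarrow>
        (\<rho> = \<sigma> \<longrightarrow> accept_prob n T \<rho> \<sigma> m [] \<ge> 2/3) \<and>
        (trace_norm (\<rho> - \<sigma>) > \<epsilon> \<longrightarrow> 1 - accept_prob n T \<rho> \<sigma> m [] \<ge> 2/3))"

end

theory Submission
  imports Defs "Jordan_Normal_Form.Schur_Decomposition"
begin

text \<open>
  Write \<open>d = 2\<^sup>n\<close> and \<open>\<delta>\<^sub>P = tr (P (\<rho> - \<sigma>))\<close>.

  Lower bound. The pair \<open>\<rho> = \<sigma> = I/d\<close> has to be distinguished from each pair
  \<open>(I - aP)/d, (I + aP)/d\<close> with \<open>a = 3\<epsilon>/4\<close>. Only queries of \<open>P\<close> itself tell them apart, and each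
  contributes \<open>O(a\<^sup>2)\<close> to the relative entropy, so every non-identity \<open>P\<close> must be queried
  \<open>\<Omega>(1/\<epsilon>\<^sup>2)\<close> times in expectation under \<open>I/d\<close>. These expectations add up to at most the number
  of copies.

  Upper bound. By Cauchy-Schwarz and Parseval, \<open>\<parallel>\<rho> - \<sigma>\<parallel>\<^sub>1\<^sup>2 \<le> \<Sum>\<^sub>P \<delta>\<^sub>P\<^sup>2\<close>. If the right-hand side
  exceeds \<open>\<epsilon>\<^sup>2\<close>, then for some level \<open>j \<le> 2n\<close> at least \<open>2\<^sup>j/(4n)\<close> of the \<open>4\<^sup>n\<close> strings satisfy
  \<open>\<delta>\<^sub>P\<^sup>2 \<ge> \<epsilon>\<^sup>2/2\<^sup>j\<^sup>+\<^sup>1\<close>. Hence it suffices to sample, for every \<open>j\<close>, \<open>O(n 4\<^sup>n/2\<^sup>j)\<close> random strings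
  and to estimate each \<open>\<delta>\<^sub>P\<close> from \<open>O(n 2\<^sup>j/\<epsilon>\<^sup>2)\<close> copies, accepting iff no estimate is large.
\<close>

section \<open>Pauli matrices\<close>

text \<open>Distributivity, by splitting off the top bit: adding \<open>2^n\<close> leaves the lower
  bits alone. This turns index sums for tensor products into products over qubits.\<close>

lemma sum_prod_bits:
  fixes f :: "nat \<Rightarrow> nat \<Rightarrow> 'a::comm_ring_1"
  shows "(\<Sum>i<2^n. \<Prod>k<n. f k (i div 2^k mod 2)) = (\<Prod>k<n. f k 0 + f k 1)"
proof (induction n)
  case (Suc n)
  have shift: "(2^n + i) div 2^k mod 2 = i div 2^k mod 2" if "k < n" for i k :: nat
  proof -
    obtain r where r: "n = Suc (k + r)" using \<open>k < n\<close> less_iff_Suc_add by auto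
    have "2^n + i = 2^k * (2 * 2^r) + i" by (simp add: r power_add)
    then have "(2^n + i) div 2^k = 2 * 2^r + i div 2^k"
      by (simp only: div_mult_self4 power_not_zero) simp
    then show ?thesis by simp
  qed
  have "(\<Sum>i<2^Suc n. \<Prod>k<Suc n. f k (i div 2^k mod 2))
      = (\<Sum>i<2^n. \<Prod>k<Suc n. f k (i div 2^k mod 2))
      + (\<Sum>i<2^n. \<Prod>k<Suc n. f k ((2^n + i) div 2^k mod 2))"
  proof -
    have "{..<2^Suc n} = {..<2^n} \<union> (\<lambda>i. 2^n + i) ` {..<2^n::nat}"
    proof (intro equalityI subsetI)
      fix x :: nat assume "x \<in> {..<2^Suc n}"
      then show "x \<in> {..<2^n} \<union> (\<lambda>i. 2^n + i) ` {..<2^n}"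
        by (cases "x < 2^n") (auto intro!: image_eqI[of _ _ "x - 2^n"])
    qed auto
    then show ?thesis
      by (simp only:) (subst sum.union_disjoint, auto simp: sum.reindex)
  qed
  also have "\<dots> = (\<Sum>i<2^n. (\<Prod>k<n. f k (i div 2^k mod 2)) * f n 0)
      + (\<Sum>i<2^n. (\<Prod>k<n. f k (i div 2^k mod 2)) * f n 1)"
  proof (intro arg_cong2[where f = "(+)"] sum.cong refl)
    fix i assume "i \<in> {..<2^n::nat}"
    then show "(\<Prod>k<Suc n. f k (i div 2^k mod 2)) = (\<Prod>k<n. f k (i div 2^k mod 2)) * f n 0"
      by simp
    from \<open>i \<in> _\<close> have "(2^n + i) div 2^n = 1" by simp
    then show "(\<Prod>k<Suc n. f k ((2^n + i) div 2^k mod 2))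
        = (\<Prod>k<n. f k (i div 2^k mod 2)) * f n 1"
      by (simp add: shift)
  qed
  also have "\<dots> = (\<Prod>k<Suc n. f k 0 + f k 1)"
    by (simp add: sum_distrib_right[symmetric] Suc distrib_left)
  finally show ?case .
qed simp

lemma bits_eqI:
  fixes i j :: nat
  assumes "i < 2^n" "j < 2^n" "\<And>k. k < n \<Longrightarrow> i div 2^k mod 2 = j div 2^k mod 2"
  shows "i = j"
  using assms
proof (induction n arbitrary: i j)
  case (Suc n)
  have "i div 2 = j div 2"
  proof (rule Suc.IH)
    fix k assume "k < n"
    then show "i div 2 div 2^k mod 2 = j div 2 div 2^k mod 2"
      using Suc.prems(3)[of "Suc k"] by (simp add: div_mult2_eq)
  qed (use Suc.prems in auto)
  moreover have "i mod 2 = j mod 2" using Suc.prems(3)[of 0] by simp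
  ultimately show ?case by (metis div_mult_mod_eq)
qed simp

lemma finite_pauli_strings [simp]: "finite (pauli_strings n)"
  using finite_lists_length_eq[of "{0..<4::nat}" n]
  by (simp add: pauli_strings_def conj_commute)

lemma card_pauli_strings: "card (pauli_strings n) = 4^n"
  using card_lists_length_eq[of "{0..<4::nat}" n]
  by (simp add: pauli_strings_def conj_commute)

lemma pauli_strings_nth: "s \<in> pauli_strings n \<Longrightarrow> k < n \<Longrightarrow> s ! k < 4"
  using nth_mem[of k s] unfolding pauli_strings_def by fastforce

text \<open>The last letter is split off, not the first, so that the other positions keep their
  indices in products over \<open>k < n\<close>.\<close>

lemma pauli_strings_Suc:
  "pauli_strings (Suc n) = (\<lambda>(s, p). s @ [p]) ` (pauli_strings n \<times> {..<4})"
proof (intro equalityI subsetI)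
  fix s assume "s \<in> pauli_strings (Suc n)"
  then show "s \<in> (\<lambda>(s, p). s @ [p]) ` (pauli_strings n \<times> {..<4})"
    by (cases s rule: rev_cases) (auto simp: pauli_strings_def)
qed (auto simp: pauli_strings_def)

lemma sum_prod_pauli_strings:
  fixes g :: "nat \<Rightarrow> nat \<Rightarrow> 'a::comm_ring_1"
  shows "(\<Sum>s\<in>pauli_strings n. \<Prod>k<n. g k (s ! k)) = (\<Prod>k<n. \<Sum>p<4. g k p)"
proof (induction n)
  case 0
  have "pauli_strings 0 = {[]}" by (auto simp: pauli_strings_def)
  then show ?case by simp
next
  case (Suc n)
  have inj: "inj_on (\<lambda>(s, p). s @ [p]) (pauli_strings n \<times> {..<4::nat})"
    by (auto simp: inj_on_def)
  have "(\<Sum>s\<in>pauli_strings (Suc n). \<Prod>k<Suc n. g k (s ! k))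
      = (\<Sum>(s,p)\<in>pauli_strings n \<times> {..<4}. \<Prod>k<Suc n. g k ((s @ [p]) ! k))"
    unfolding pauli_strings_Suc by (subst sum.reindex[OF inj]) (simp add: case_prod_unfold)
  also have "\<dots> = (\<Sum>(s,p)\<in>pauli_strings n \<times> {..<4}. (\<Prod>k<n. g k (s ! k)) * g n p)"
    by (intro sum.cong refl) (auto simp: pauli_strings_def nth_append)
  also have "\<dots> = (\<Sum>s\<in>pauli_strings n. \<Prod>k<n. g k (s ! k)) * (\<Sum>p<4. g n p)"
    by (simp add: sum.cartesian_product[symmetric] sum_product)
  finally show ?case by (simp add: Suc)
qed

section \<open>Orthogonality and completeness of the Pauli matrices\<close>

lemma mtrace_mult:
  assumes "A \<in> carrier_mat d d" "B \<in> carrier_mat d d"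
  shows "mtrace (A * B) = (\<Sum>i<d. \<Sum>j<d. A $$ (i,j) * B $$ (j,i))"
  using assms unfolding mtrace_def
  by (auto simp: scalar_prod_def atLeast0LessThan intro!: sum.cong)

lemma mtrace_mult_commute:
  assumes "A \<in> carrier_mat d d" "B \<in> carrier_mat d d"
  shows "mtrace (A * B) = mtrace (B * A)"
  unfolding mtrace_mult[OF assms] mtrace_mult[OF assms(2,1)]
  by (subst sum.swap) (simp add: mult.commute)

lemma pauli_mat_carrier [simp]: "pauli_mat n s \<in> carrier_mat (2^n) (2^n)"
  by (simp add: pauli_mat_def)

lemma pauli_mat_dim [simp]: "dim_row (pauli_mat n s) = 2^n" "dim_col (pauli_mat n s) = 2^n"
  by (simp_all add: pauli_mat_def)

lemma pauli_mat_index: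
  "i < 2^n \<Longrightarrow> j < 2^n \<Longrightarrow>
   pauli_mat n s $$ (i,j) = (\<Prod>k<n. pauli1 (s ! k) (i div 2^k mod 2) (j div 2^k mod 2))"
  by (simp add: pauli_mat_def)

lemma cnj_pauli1: "cnj (pauli1 p a b) = pauli1 p b a"
  by (auto simp: pauli1_def)

text \<open>The trace of a product of two single-qubit Paulis, spelled out in the shape left by two
  uses of \<open>sum_prod_bits\<close>.\<close>

lemma pauli1_orthogonal:
  "p < 4 \<Longrightarrow> q < 4 \<Longrightarrow>
   (pauli1 p 0 0 * pauli1 q 0 0 + pauli1 p 0 1 * pauli1 q 1 0) +
   (pauli1 p 1 0 * pauli1 q 0 1 + pauli1 p 1 1 * pauli1 q 1 1) = (if p = q then 2 else 0)"
  by (auto simp: pauli1_def)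

lemma pauli1_involution:
  "a < 2 \<Longrightarrow> c < 2 \<Longrightarrow>
   pauli1 p a 0 * pauli1 p 0 c + pauli1 p a 1 * pauli1 p 1 c = (if a = c then 1 else 0)"
  by (auto simp: pauli1_def less_2_cases_iff)

text \<open>In operator form: the four matrices \<open>P \<otimes> P\<close> add up to twice the
  swap of two qubits.\<close>

lemma pauli1_complete:
  "a < 2 \<Longrightarrow> b < 2 \<Longrightarrow> c < 2 \<Longrightarrow> d < 2 \<Longrightarrow>
   (\<Sum>p<4. pauli1 p a b * pauli1 p c d) = (if a = d \<and> b = c then 2 else 0)"
  by (auto simp: pauli1_def less_2_cases_iff eval_nat_numeral)

lemma cnj_pauli_mat:
  "i < 2^n \<Longrightarrow> j < 2^n \<Longrightarrow> cnj (pauli_mat n s $$ (i,j)) = pauli_mat n s $$ (j,i)"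
  by (simp add: pauli_mat_index cnj_pauli1)

lemma prod_indicator:
  "finite A \<Longrightarrow> (\<Prod>k\<in>A. if P k then c else (0::'a::comm_semiring_1)) = (if \<forall>k\<in>A. P k then c ^ card A else 0)"
  by (induction A rule: finite_induct) auto

text \<open>Both index sums factor over the qubits, so the trace is a product of single-qubit traces
  and vanishes as soon as one letter differs.\<close>

lemma pauli_mat_orthogonal:
  assumes "s \<in> pauli_strings n" "t \<in> pauli_strings n"
  shows "mtrace (pauli_mat n s * pauli_mat n t) = (if s = t then 2^n else 0)"
proof -
  have eq: "(\<forall>k\<in>{..<n}. s ! k = t ! k) \<longleftrightarrow> s = t"
    using assms by (auto simp: pauli_strings_def list_eq_iff_nth_eq)
  have "mtrace (pauli_mat n s * pauli_mat n t)
      = (\<Sum>i<2^n. \<Sum>j<2^n. \<Prod>k<n. pauli1 (s!k) (i div 2^k mod 2) (j div 2^k mod 2) *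
                                 pauli1 (t!k) (j div 2^k mod 2) (i div 2^k mod 2))"
    by (subst mtrace_mult[where d = "2^n"]) (auto simp: pauli_mat_index prod.distrib)
  also have "\<dots> = (\<Sum>i<2^n. \<Prod>k<n. pauli1 (s!k) (i div 2^k mod 2) 0 * pauli1 (t!k) 0 (i div 2^k mod 2)
                                 + pauli1 (s!k) (i div 2^k mod 2) 1 * pauli1 (t!k) 1 (i div 2^k mod 2))"
    by (subst sum_prod_bits[where f = "\<lambda>k b. pauli1 (s!k) (i div 2^k mod 2) b * pauli1 (t!k) b (i div 2^k mod 2)" for i])
       simp
  also have "\<dots> = (\<Prod>k<n. if s ! k = t ! k then 2 else 0)"
    by (subst sum_prod_bits[where f = "\<lambda>k a. pauli1 (s!k) a 0 * pauli1 (t!k) 0 a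
                                 + pauli1 (s!k) a 1 * pauli1 (t!k) 1 a"])
       (intro prod.cong refl pauli1_orthogonal pauli_strings_nth[of _ n]; use assms in simp)
  also have "\<dots> = (if s = t then 2^n else 0)"
    by (simp only: prod_indicator[OF finite_lessThan] eq card_lessThan)
  finally show ?thesis .
qed

lemma pauli_mat_involution:
  assumes "i < 2^n" "l < 2^n"
  shows "(\<Sum>j<2^n. pauli_mat n s $$ (i,j) * pauli_mat n s $$ (j,l)) = (if i = l then 1 else 0)"
proof -
  have eq: "(\<forall>k\<in>{..<n}. i div 2^k mod 2 = l div 2^k mod 2) \<longleftrightarrow> i = l"
    using bits_eqI[of i n l] assms by auto
  have "(\<Sum>j<2^n. pauli_mat n s $$ (i,j) * pauli_mat n s $$ (j,l))
      = (\<Sum>j<2^n. \<Prod>k<n. pauli1 (s!k) (i div 2^k mod 2) (j div 2^k mod 2) *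
                                 pauli1 (s!k) (j div 2^k mod 2) (l div 2^k mod 2))"
    using assms by (simp add: pauli_mat_index prod.distrib)
  also have "\<dots> = (\<Prod>k<n. if i div 2^k mod 2 = l div 2^k mod 2 then 1 else 0)"
    by (subst sum_prod_bits[where f = "\<lambda>k b. pauli1 (s!k) (i div 2^k mod 2) b * pauli1 (s!k) b (l div 2^k mod 2)"])
       (intro prod.cong refl pauli1_involution; simp)
  also have "\<dots> = (if i = l then 1 else 0)"
    by (simp only: prod_indicator[OF finite_lessThan] eq power_one)
  finally show ?thesis .
qed

text \<open>The tensor power of \<open>pauli1_complete\<close>; it collapses the index sums in
  \<open>pauli_parseval\<close>.\<close>

lemma pauli_mat_complete:
  assumes "i < 2^n" "j < 2^n" "k < 2^n" "l < 2^n"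
  shows "(\<Sum>s\<in>pauli_strings n. pauli_mat n s $$ (i,j) * pauli_mat n s $$ (k,l))
       = (if i = l \<and> j = k then 2^n else 0)"
proof -
  have eq: "(\<forall>r\<in>{..<n}. i div 2^r mod 2 = l div 2^r mod 2 \<and> j div 2^r mod 2 = k div 2^r mod 2)
     \<longleftrightarrow> i = l \<and> j = k"
    using bits_eqI[of i n l] bits_eqI[of j n k] assms by auto
  have "(\<Sum>s\<in>pauli_strings n. pauli_mat n s $$ (i,j) * pauli_mat n s $$ (k,l))
      = (\<Sum>s\<in>pauli_strings n. \<Prod>r<n. pauli1 (s!r) (i div 2^r mod 2) (j div 2^r mod 2) *
                                 pauli1 (s!r) (k div 2^r mod 2) (l div 2^r mod 2))"
    using assms by (simp add: pauli_mat_index prod.distrib)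
  also have "\<dots> = (\<Prod>r<n. if i div 2^r mod 2 = l div 2^r mod 2 \<and> j div 2^r mod 2 = k div 2^r mod 2 then 2 else 0)"
    by (subst sum_prod_pauli_strings[where g = "\<lambda>r p. pauli1 p (i div 2^r mod 2) (j div 2^r mod 2) *
                                 pauli1 p (k div 2^r mod 2) (l div 2^r mod 2)"])
       (intro prod.cong refl pauli1_complete; simp)
  also have "\<dots> = (if i = l \<and> j = k then 2^n else 0)"
    by (simp only: prod_indicator[OF finite_lessThan] eq card_lessThan)
  finally show ?thesis .
qed

text \<open>Makes the identity a Pauli string, so that traces against it fall under
  \<open>pauli_mat_orthogonal\<close>.\<close>

lemma pauli_mat_replicate_0: "pauli_mat n (replicate n 0) = 1\<^sub>m (2^n)"
proof (rule eq_matI)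
  fix i j assume "i < dim_row (1\<^sub>m (2^n) :: complex mat)" "j < dim_col (1\<^sub>m (2^n) :: complex mat)"
  then have ij: "i < 2^n" "j < 2^n" by auto
  have eq: "(\<forall>k\<in>{..<n}. i div 2^k mod 2 = j div 2^k mod 2) \<longleftrightarrow> i = j"
    using bits_eqI[OF ij] by auto
  have "pauli_mat n (replicate n 0) $$ (i,j) = (\<Prod>k<n. if i div 2^k mod 2 = j div 2^k mod 2 then 1 else 0)"
    unfolding pauli_mat_index[OF ij] by (intro prod.cong) (auto simp: pauli1_def)
  also have "\<dots> = (if i = j then 1 else 0)"
    by (simp only: prod_indicator[OF finite_lessThan] eq power_one)
  finally show "pauli_mat n (replicate n 0) $$ (i,j) = 1\<^sub>m (2^n) $$ (i,j)" using ij by simp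
qed (auto)

lemma replicate_0_pauli_strings: "replicate n 0 \<in> pauli_strings n"
  by (auto simp: pauli_strings_def)

section \<open>Trace norm and Pauli coefficients\<close>

definition pauli_coeff :: "nat \<Rightarrow> complex mat \<Rightarrow> nat list \<Rightarrow> real" where
  "pauli_coeff n \<rho> s = Re (mtrace (pauli_mat n s * \<rho>))"

lemma density_matrixD:
  assumes "density_matrix n \<rho>"
  shows "\<rho> \<in> carrier_mat (2^n) (2^n)" "mtrace \<rho> = 1"
    "\<And>i j. i < 2^n \<Longrightarrow> j < 2^n \<Longrightarrow> cnj (\<rho> $$ (i,j)) = \<rho> $$ (j,i)"
    "\<And>v. 0 \<le> Re (\<Sum>i<2^n. \<Sum>j<2^n. cnj (v i) * \<rho> $$ (i,j) * v j)"
proof -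
  show c: "\<rho> \<in> carrier_mat (2^n) (2^n)" and "mtrace \<rho> = 1"
    and "\<And>v. 0 \<le> Re (\<Sum>i<2^n. \<Sum>j<2^n. cnj (v i) * \<rho> $$ (i,j) * v j)"
    using assms by (auto simp: density_matrix_def)
  fix i j :: nat assume "i < 2^n" "j < 2^n"
  then have "adj \<rho> $$ (j,i) = cnj (\<rho> $$ (i,j))" using c by (simp add: adj_def)
  then show "cnj (\<rho> $$ (i,j)) = \<rho> $$ (j,i)" using assms by (simp add: density_matrix_def)
qed

lemma pauli_coeff_alt:
  assumes "A \<in> carrier_mat (2^n) (2^n)"
  shows "pauli_coeff n A s = Re (\<Sum>i<2^n. \<Sum>j<2^n. pauli_mat n s $$ (i,j) * A $$ (j,i))"
  unfolding pauli_coeff_def using assms by (subst mtrace_mult[where d = "2^n"]) auto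

text \<open>The outcome is a coin with mean \<open>pauli_coeff n \<rho> s\<close>: a tester sees a
  state only through its Pauli coefficients.\<close>

lemma pauli_outcome_prob_eq:
  assumes "\<rho> \<in> carrier_mat (2^n) (2^n)" "mtrace \<rho> = 1"
  shows "pauli_outcome_prob n \<rho> s b = (1 + (if b then 1 else -1) * pauli_coeff n \<rho> s) / 2"
proof -
  let ?c = "if b then 1 else -1 :: complex"
  let ?M = "(1/2) \<cdot>\<^sub>m (if b then 1\<^sub>m (2^n) + pauli_mat n s else 1\<^sub>m (2^n) - pauli_mat n s)"
  have M: "?M \<in> carrier_mat (2^n) (2^n)" by (auto intro: minus_carrier_mat)
  have ent: "?M $$ (i,j) = (1/2) * ((if i = j then 1 else 0) + ?c * pauli_mat n s $$ (i,j))"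
    if "i < 2^n" "j < 2^n" for i j using that by simp
  have "mtrace (?M * \<rho>) = (\<Sum>i<2^n. \<Sum>j<2^n. ?M $$ (i,j) * \<rho> $$ (j,i))"
    by (rule mtrace_mult[OF M assms(1)])
  also have "\<dots> = (\<Sum>i<2^n. \<Sum>j<2^n. (1/2) * ((if i = j then \<rho> $$ (j,i) else 0)
                     + ?c * (pauli_mat n s $$ (i,j) * \<rho> $$ (j,i))))"
    by (intro sum.cong refl, subst ent) (auto simp: algebra_simps)
  also have "\<dots> = (1/2) * ((\<Sum>i<2^n. \<rho> $$ (i,i))
                     + ?c * (\<Sum>i<2^n. \<Sum>j<2^n. pauli_mat n s $$ (i,j) * \<rho> $$ (j,i)))"
    unfolding sum_distrib_left[symmetric] sum.distrib by simp
  also have "(\<Sum>i<2^n. \<rho> $$ (i,i)) = 1"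
    using assms by (simp add: mtrace_def)
  finally have "mtrace (?M * \<rho>)
      = (1/2) * (1 + ?c * (\<Sum>i<2^n. \<Sum>j<2^n. pauli_mat n s $$ (i,j) * \<rho> $$ (j,i)))" .
  then show ?thesis
    unfolding pauli_outcome_prob_def pauli_coeff_alt[OF assms(1)] by (simp only:) (simp del: Re_sum)
qed

text \<open>\<open>(I + cP) \<cdot> (I + cP) = 2 (I + cP)\<close> for a sign \<open>c\<close>, so the quadratic forms of \<open>\<rho>\<close> at
  the columns of \<open>I + cP\<close> add up to twice the Born probability.\<close>

lemma abs_pauli_coeff_le_1:
  assumes "density_matrix n \<rho>"
  shows "\<bar>pauli_coeff n \<rho> s\<bar> \<le> 1"
proof -
  note D = density_matrixD[OF assms]
  let ?P = "\<lambda>i j. pauli_mat n s $$ (i,j)"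
  have "0 \<le> 1 + c * pauli_coeff n \<rho> s" if c: "c = 1 \<or> c = -1" for c :: real
  proof -
    define M where "M = (\<lambda>i j. (if i = j then 1 else 0) + complex_of_real c * ?P i j)"
    have sq: "(\<Sum>l<2^n. M j l * cnj (M i l)) = 2 * M j i" if ij: "i < 2^n" "j < 2^n" for i j
    proof -
      have "(\<Sum>l<2^n. M j l * cnj (M i l)) = (\<Sum>l<2^n. M j l * M l i)"
        using ij by (intro sum.cong refl) (auto simp: M_def cnj_pauli_mat)
      also have "\<dots> = (\<Sum>l<2^n. (if l = i then M j i else 0) + (if j = l then of_real c * ?P j i else 0)
           + ?P j l * ?P l i)"
        using ij c by (intro sum.cong refl) (auto simp: M_def algebra_simps)
      also have "\<dots> = M j i + of_real c * ?P j i + (if j = i then 1 else 0)"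
        using ij by (simp add: sum.distrib pauli_mat_involution)
      also have "\<dots> = 2 * M j i" by (simp add: M_def)
      finally show ?thesis .
    qed
    have "0 \<le> (\<Sum>l<2^n. Re (\<Sum>i<2^n. \<Sum>j<2^n. cnj (M i l) * \<rho> $$ (i,j) * M j l))"
      by (intro sum_nonneg D(4))
    also have "\<dots> = Re (\<Sum>l<2^n. \<Sum>i<2^n. \<Sum>j<2^n. cnj (M i l) * \<rho> $$ (i,j) * M j l)"
      by simp
    also have "(\<Sum>l<2^n. \<Sum>i<2^n. \<Sum>j<2^n. cnj (M i l) * \<rho> $$ (i,j) * M j l)
       = (\<Sum>i<2^n. \<Sum>j<2^n. \<rho> $$ (i,j) * (\<Sum>l<2^n. M j l * cnj (M i l)))"
      unfolding sum_distrib_left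
      by (subst sum.swap, rule sum.cong[OF refl], subst sum.swap) (simp add: mult_ac)
    also have "\<dots> = (\<Sum>i<2^n. \<Sum>j<2^n. 2 * ((if j = i then \<rho> $$ (i,i) else 0)
           + of_real c * (\<rho> $$ (i,j) * ?P j i)))"
      by (intro sum.cong refl, subst sq) (auto simp: M_def algebra_simps)
    also have "\<dots> = 2 * ((\<Sum>i<2^n. \<rho> $$ (i,i)) + of_real c * (\<Sum>i<2^n. \<Sum>j<2^n. \<rho> $$ (i,j) * ?P j i))"
      unfolding sum_distrib_left[symmetric] sum.distrib by simp
    also have "(\<Sum>i<2^n. \<rho> $$ (i,i)) = 1" using D(1,2) by (simp add: mtrace_def)
    also have "(\<Sum>i<2^n. \<Sum>j<2^n. \<rho> $$ (i,j) * ?P j i) = (\<Sum>i<2^n. \<Sum>j<2^n. ?P i j * \<rho> $$ (j,i))"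
      by (subst sum.swap) (simp add: mult.commute)
    finally show ?thesis by (simp add: pauli_coeff_alt[OF D(1)])
  qed
  from this[of 1] this[of "-1"] show ?thesis by auto
qed

section \<open>Parseval identity and trace norm\<close>

lemma mtrace_adj_mult:
  assumes "A \<in> carrier_mat d d"
  shows "mtrace (adj A * A) = of_real (\<Sum>i<d. \<Sum>j<d. (cmod (A $$ (i,j)))\<^sup>2)"
proof -
  have "mtrace (adj A * A) = (\<Sum>i<d. \<Sum>j<d. adj A $$ (i,j) * A $$ (j,i))"
    using assms by (intro mtrace_mult) (auto simp: adj_def)
  also have "\<dots> = (\<Sum>i<d. \<Sum>j<d. of_real ((cmod (A $$ (j,i)))\<^sup>2))"
    using assms by (intro sum.cong refl) (auto simp: adj_def complex_norm_square mult.commute simp del: of_real_power)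
  finally show ?thesis by (subst sum.swap) simp
qed

text \<open>Expand the squared traces and sum over the strings first: completeness leaves
  \<open>2^n\<close> times the trace of \<open>A * A\<close>, which is the squared Frobenius norm
  because \<open>A\<close> is Hermitian.\<close>

lemma pauli_parseval:
  assumes A: "A \<in> carrier_mat (2^n) (2^n)"
    and herm: "\<And>i j. i < 2^n \<Longrightarrow> j < 2^n \<Longrightarrow> cnj (A $$ (i,j)) = A $$ (j,i)"
  shows "(\<Sum>s\<in>pauli_strings n. (pauli_coeff n A s)\<^sup>2) = 2^n * (\<Sum>i<2^n. \<Sum>j<2^n. (cmod (A $$ (i,j)))\<^sup>2)"
proof -
  let ?P = "\<lambda>s i j. pauli_mat n s $$ (i,j)"
  let ?t = "\<lambda>s. \<Sum>i<2^n. \<Sum>j<2^n. ?P s i j * A $$ (j,i)"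
  \<comment> \<open>\<open>pauli_coeff\<close> takes a real part; here the trace is already real, as
    both factors are Hermitian.\<close>
  have real: "of_real (pauli_coeff n A s) = ?t s" for s
  proof -
    have "cnj (?t s) = (\<Sum>i<2^n. \<Sum>j<2^n. ?P s j i * A $$ (i,j))"
      unfolding cnj_sum by (intro sum.cong refl) (auto simp: cnj_pauli_mat herm)
    also have "\<dots> = ?t s" by (rule sum.swap)
    finally have "?t s \<in> \<real>" by (simp only: Reals_cnj_iff)
    then show ?thesis by (simp add: pauli_coeff_alt[OF A] del: Re_sum)
  qed
  have "of_real (\<Sum>s\<in>pauli_strings n. (pauli_coeff n A s)\<^sup>2) = (\<Sum>s\<in>pauli_strings n. ?t s * ?t s)"
    by (simp add: real power2_eq_square)
  also have "\<dots> = (\<Sum>s\<in>pauli_strings n. \<Sum>i<2^n. \<Sum>j<2^n. \<Sum>k<2^n. \<Sum>l<2^n.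
        (A $$ (j,i) * A $$ (l,k)) * (?P s i j * ?P s k l))"
    unfolding sum_distrib_right unfolding sum_distrib_left
    by (intro sum.cong refl) (simp add: mult_ac)
  also have "\<dots> = (\<Sum>i<2^n. \<Sum>j<2^n. \<Sum>k<2^n. \<Sum>l<2^n. \<Sum>s\<in>pauli_strings n.
        (A $$ (j,i) * A $$ (l,k)) * (?P s i j * ?P s k l))"
    by (subst sum.swap, intro sum.cong refl, subst sum.swap, intro sum.cong refl,
        subst sum.swap, intro sum.cong refl, subst sum.swap, rule refl)
  also have "\<dots> = (\<Sum>i<2^n. \<Sum>j<2^n. \<Sum>k<2^n. \<Sum>l<2^n.
        (if l = i then if k = j then A $$ (j,i) * A $$ (i,j) * 2^n else 0 else 0))"
    by (intro sum.cong refl) (auto simp: sum_distrib_left[symmetric] pauli_mat_complete)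
  also have "\<dots> = (\<Sum>i<2^n. \<Sum>j<2^n. A $$ (j,i) * A $$ (i,j) * 2^n)"
    by simp
  also have "\<dots> = (\<Sum>i<2^n. \<Sum>j<2^n. of_real ((cmod (A $$ (i,j)))\<^sup>2) * 2^n)"
    by (intro sum.cong refl) (auto simp: complex_norm_square herm mult.commute simp del: of_real_power)
  also have "\<dots> = of_real (2^n * (\<Sum>i<2^n. \<Sum>j<2^n. (cmod (A $$ (i,j)))\<^sup>2))"
    by (simp add: sum_distrib_left mult.commute)
  finally show ?thesis by (simp only: of_real_eq_iff)
qed

text \<open>An eigenvector \<open>v\<close> for \<open>z\<close> satisfies z |v|^2 = |A v|^2. Hence
  the square roots in \<open>trace_norm\<close> are taken of nonnegative numbers.\<close>

lemma char_poly_adj_mult_root_nonneg: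
  assumes A: "A \<in> carrier_mat d d" and z: "poly (char_poly (adj A * A)) z = 0"
  shows "0 \<le> Re z"
proof -
  have B: "adj A * A \<in> carrier_mat d d" using A by (auto simp: adj_def)
  obtain v where v: "v \<in> carrier_vec d" "v \<noteq> 0\<^sub>v d" "(adj A * A) *\<^sub>v v = z \<cdot>\<^sub>v v"
    using z B unfolding eigenvalue_root_char_poly[OF B, symmetric] eigenvalue_def eigenvector_def by auto
  define w where "w = (\<lambda>i. \<Sum>j<d. A $$ (i,j) * v $ j)"
  have ent: "(\<Sum>k<d. cnj (A $$ (k,i)) * w k) = z * v $ i" if "i < d" for i
  proof -
    have "z * v $ i = ((adj A * A) *\<^sub>v v) $ i" using v that by simp
    also have "\<dots> = (\<Sum>j<d. (\<Sum>k<d. cnj (A $$ (k,i)) * A $$ (k,j)) * v $ j)"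
      using A v(1) that by (simp add: scalar_prod_def adj_def atLeast0LessThan del: assoc_mult_mat_vec)
    also have "\<dots> = (\<Sum>k<d. cnj (A $$ (k,i)) * w k)"
      unfolding w_def sum_distrib_left sum_distrib_right
      by (subst sum.swap) (simp add: mult.assoc)
    finally show ?thesis ..
  qed
  have "z * of_real (\<Sum>i<d. (cmod (v $ i))\<^sup>2) = (\<Sum>i<d. cnj (v $ i) * (z * v $ i))"
    by (simp add: sum_distrib_left complex_norm_square mult_ac del: of_real_power)
  also have "\<dots> = (\<Sum>i<d. cnj (v $ i) * (\<Sum>k<d. cnj (A $$ (k,i)) * w k))"
    by (simp add: ent)
  also have "\<dots> = (\<Sum>k<d. cnj (w k) * w k)"
    unfolding w_def cnj_sum sum_distrib_left[of "cnj _"] sum_distrib_right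
    by (subst sum.swap) (simp add: sum_distrib_left sum_distrib_right mult_ac)
  also have "\<dots> = of_real (\<Sum>k<d. (cmod (w k))\<^sup>2)"
    by (simp add: complex_norm_square mult.commute del: of_real_power)
  finally have "Re z * (\<Sum>i<d. (cmod (v $ i))\<^sup>2) = (\<Sum>k<d. (cmod (w k))\<^sup>2)"
    by (simp add: complex_eq_iff)
  moreover have "0 < (\<Sum>i<d. (cmod (v $ i))\<^sup>2)"
  proof -
    obtain i where "i < d" "v $ i \<noteq> 0" using v(1,2) by (metis carrier_vecD eq_vecI index_zero_vec)
    then show ?thesis by (intro sum_pos2[of _ i]) auto
  qed
  moreover have "0 \<le> (\<Sum>k<d. (cmod (w k))\<^sup>2)" by (intro sum_nonneg) simp
  ultimately show ?thesis by (metis zero_le_mult_iff not_less)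
qed

text \<open>Schur decomposition: \<open>A\<close> is similar to a triangular matrix with the roots
  on its diagonal, and the trace is cyclic.\<close>

lemma mtrace_eq_sum_proots:
  assumes A: "A \<in> carrier_mat d d"
  shows "mtrace A = sum_mset (proots (char_poly A))" "size (proots (char_poly A)) = d"
proof -
  obtain as where as: "char_poly A = (\<Prod>a\<leftarrow>as. [:- a, 1:])" "length as = d"
    using char_poly_factorized[OF A] by blast
  have "proots (\<Prod>a\<leftarrow>xs. [:- a, 1:]) = mset xs" for xs :: "complex list"
  proof (induction xs)
    case (Cons a xs)
    have "(\<Prod>a\<leftarrow>xs. [:- a, 1:]) \<noteq> 0" by auto
    then have "proots ([:- a, 1:] * (\<Prod>a\<leftarrow>xs. [:- a, 1:])) = {#a#} + mset xs"
      by (subst proots_mult) (auto simp: Cons)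
    then show ?case by simp
  qed simp
  then have pr: "proots (char_poly A) = mset as" by (simp add: as(1))
  then show "size (proots (char_poly A)) = d" using as(2) by simp
  obtain B P Q where schur: "schur_decomposition A as = (B,P,Q)" by (cases "schur_decomposition A as") auto
  from schur_decomposition[OF A as(1) schur]
  have wit: "similar_mat_wit A B P Q" and diag: "diag_mat B = as" by auto
  from similar_mat_witD2[OF A wit] have
    *: "P * Q = 1\<^sub>m d" "Q * P = 1\<^sub>m d" "A = P * B * Q" "B \<in> carrier_mat d d" "P \<in> carrier_mat d d" "Q \<in> carrier_mat d d"
    by auto
  have "mtrace A = mtrace (Q * (P * B))" using * by (subst *(3), intro mtrace_mult_commute) auto
  also have "Q * (P * B) = B" using * by (simp add: assoc_mult_mat[symmetric, of Q d d P d B d])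
  also have "mtrace B = sum_list (diag_mat B)"
    by (simp add: mtrace_def diag_mat_def interv_sum_list_conv_sum_set_nat atLeast0LessThan)
  finally show "mtrace A = sum_mset (proots (char_poly A))" by (simp add: diag pr sum_mset_sum_list)
qed

text \<open>Cauchy-Schwarz against the constant one, over multisets because eigenvalues carry
  multiplicities.\<close>

lemma sum_mset_sqrt_le:
  fixes f :: "'a \<Rightarrow> real"
  assumes "\<And>x. x \<in># M \<Longrightarrow> 0 \<le> f x"
  shows "(\<Sum>x\<in>#M. sqrt (f x)) \<ge> 0 \<and> (\<Sum>x\<in>#M. sqrt (f x))\<^sup>2 \<le> real (size M) * (\<Sum>x\<in>#M. f x)"
  using assms
proof (induction M)
  case (add x M)
  define S T N where "S = (\<Sum>x\<in>#M. sqrt (f x))" and "T = (\<Sum>x\<in>#M. f x)" and "N = real (size M)"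
  have IH: "0 \<le> S" "S\<^sup>2 \<le> N * T" and fx: "0 \<le> f x" using add by (auto simp: S_def T_def N_def)
  have "2 * (sqrt (f x) * S) \<le> N * f x + T"
  proof (cases "N = 0")
    case True
    then show ?thesis using IH fx by (auto simp: N_def S_def T_def)
  next
    case False
    then have "N > 0" by (auto simp: N_def nonempty_has_size)
    have "0 \<le> (N * sqrt (f x) - S)\<^sup>2" by simp
    also have "\<dots> = N\<^sup>2 * f x - 2 * N * (sqrt (f x) * S) + S\<^sup>2"
      using fx by (simp add: power2_diff algebra_simps)
    also have "\<dots> \<le> N\<^sup>2 * f x - 2 * N * (sqrt (f x) * S) + N * T" using IH by simp
    also have "\<dots> = N * (N * f x + T - 2 * (sqrt (f x) * S))" by (simp add: algebra_simps power2_eq_square)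
    finally show ?thesis using \<open>N > 0\<close> by (simp add: zero_le_mult_iff)
  qed
  then have "(sqrt (f x) + S)\<^sup>2 \<le> (1 + N) * (f x + T)"
    using IH fx by (simp add: power2_sum algebra_simps)
  then show ?case using IH fx by (simp add: S_def T_def N_def)
qed simp

lemma Re_sum_mset: "Re (sum_mset M) = (\<Sum>z\<in>#M. Re z)"
  by (induction M) auto

text \<open>Cauchy-Schwarz for the \<open>d\<close> singular values, whose squares add up to the
  trace of \<open>adj A * A\<close>.\<close>

lemma trace_norm_sq_le:
  assumes A: "A \<in> carrier_mat d d"
  shows "(trace_norm A)\<^sup>2 \<le> d * (\<Sum>i<d. \<Sum>j<d. (cmod (A $$ (i,j)))\<^sup>2)"
proof -
  have B: "adj A * A \<in> carrier_mat d d" using A by (auto simp: adj_def)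
  have nz: "char_poly (adj A * A) \<noteq> 0" using degree_monic_char_poly[OF B] by auto
  have nn: "0 \<le> Re z" if "z \<in># proots (char_poly (adj A * A))" for z
    using that nz char_poly_adj_mult_root_nonneg[OF A] by simp
  have "(\<Sum>z\<in>#proots (char_poly (adj A * A)). Re z) = Re (mtrace (adj A * A))"
    unfolding mtrace_eq_sum_proots(1)[OF B] by (rule Re_sum_mset[symmetric])
  also have "\<dots> = (\<Sum>i<d. \<Sum>j<d. (cmod (A $$ (i,j)))\<^sup>2)"
    unfolding mtrace_adj_mult[OF A] by (simp only: Re_complex_of_real)
  finally show "(trace_norm A)\<^sup>2 \<le> d * (\<Sum>i<d. \<Sum>j<d. (cmod (A $$ (i,j)))\<^sup>2)"
    using sum_mset_sqrt_le[of "proots (char_poly (adj A * A))" Re] nn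
    unfolding trace_norm_def mtrace_eq_sum_proots(2)[OF B] by auto
qed

text \<open>The factor \<open>2^n\<close> from Cauchy-Schwarz is exactly the one in Parseval, so no
  dimension factor remains.\<close>

lemma trace_norm_diff_le_pauli_coeff:
  assumes "density_matrix n \<rho>" "density_matrix n \<sigma>"
  shows "(trace_norm (\<rho> - \<sigma>))\<^sup>2 \<le> (\<Sum>s\<in>pauli_strings n. (pauli_coeff n \<rho> s - pauli_coeff n \<sigma> s)\<^sup>2)"
proof -
  note R = density_matrixD[OF assms(1)] and S = density_matrixD[OF assms(2)]
  have c: "\<rho> - \<sigma> \<in> carrier_mat (2^n) (2^n)" using R(1) S(1) by (intro minus_carrier_mat)
  have coeff: "pauli_coeff n (\<rho> - \<sigma>) s = pauli_coeff n \<rho> s - pauli_coeff n \<sigma> s" for s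
    unfolding pauli_coeff_alt[OF c] pauli_coeff_alt[OF R(1)] pauli_coeff_alt[OF S(1)]
      minus_complex.sel(1)[symmetric] sum_subtractf[symmetric]
    using R(1) S(1) by (intro arg_cong[where f = Re] sum.cong refl) (auto simp: algebra_simps)
  have "(\<Sum>s\<in>pauli_strings n. (pauli_coeff n (\<rho> - \<sigma>) s)\<^sup>2)
      = 2^n * (\<Sum>i<2^n. \<Sum>j<2^n. (cmod ((\<rho> - \<sigma>) $$ (i,j)))\<^sup>2)"
    using R(1,3) S(1,3) by (intro pauli_parseval[OF c]) auto
  then show ?thesis using trace_norm_sq_le[OF c] by (simp add: coeff)
qed

section \<open>Lower bound\<close>

text \<open>For \<open>c = 0\<close> this is the maximally mixed state, whatever \<open>s\<close>
  is.\<close>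

definition pauli_state :: "nat \<Rightarrow> real \<Rightarrow> nat list \<Rightarrow> complex mat" where
  "pauli_state n c s = mat (2^n) (2^n)
     (\<lambda>(i,j). ((if i = j then 1 else 0) + of_real c * pauli_mat n s $$ (i,j)) / 2^n)"

lemma pauli_state_carrier [simp]: "pauli_state n c s \<in> carrier_mat (2^n) (2^n)"
  by (simp add: pauli_state_def)

lemma pauli_state_index:
  "i < 2^n \<Longrightarrow> j < 2^n \<Longrightarrow>
   pauli_state n c s $$ (i,j) = ((if i = j then 1 else 0) + of_real c * pauli_mat n s $$ (i,j)) / 2^n"
  by (simp add: pauli_state_def)

lemma mtrace_pauli_mat_mult_pauli_state:
  assumes "s \<in> pauli_strings n" "t \<in> pauli_strings n"
  shows "mtrace (pauli_mat n t * pauli_state n c s)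
       = of_real ((if t = replicate n 0 then 1 else 0) + c * (if t = s then 1 else 0))"
proof -
  let ?P = "\<lambda>s i j. pauli_mat n s $$ (i,j)"
  let ?I = "replicate n 0"
  have "mtrace (pauli_mat n t * pauli_state n c s)
      = (\<Sum>i<2^n. \<Sum>j<2^n. ?P t i j * pauli_state n c s $$ (j,i))"
    by (rule mtrace_mult) auto
  also have "\<dots> = (\<Sum>i<2^n. \<Sum>j<2^n. (?P t i j * ?P ?I j i) / 2^n + of_real c / 2^n * (?P t i j * ?P s j i))"
    by (intro sum.cong refl)
       (auto simp: pauli_state_index pauli_mat_replicate_0 add_divide_distrib algebra_simps)
  also have "\<dots> = (\<Sum>i<2^n. \<Sum>j<2^n. ?P t i j * ?P ?I j i) / 2^n
       + of_real c / 2^n * (\<Sum>i<2^n. \<Sum>j<2^n. ?P t i j * ?P s j i)"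
    unfolding sum.distrib sum_distrib_left sum_divide_distrib ..
  also have "\<dots> = mtrace (pauli_mat n t * pauli_mat n ?I) / 2^n
       + of_real c / 2^n * mtrace (pauli_mat n t * pauli_mat n s)"
    by (subst (1 2) mtrace_mult[where d = "2^n"]) auto
  finally show ?thesis
    using assms by (simp add: pauli_mat_orthogonal replicate_0_pauli_strings)
qed

lemma pauli_coeff_pauli_state:
  assumes "s \<in> pauli_strings n" "t \<in> pauli_strings n"
  shows "pauli_coeff n (pauli_state n c s) t
       = (if t = replicate n 0 then 1 else 0) + c * (if t = s then 1 else 0)"
  unfolding pauli_coeff_def mtrace_pauli_mat_mult_pauli_state[OF assms] by (rule Re_complex_of_real)

lemma mtrace_pauli_state:
  assumes "s \<in> pauli_strings n" "c = 0 \<or> s \<noteq> replicate n 0"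
  shows "mtrace (pauli_state n c s) = 1"
  using mtrace_pauli_mat_mult_pauli_state[OF assms(1) replicate_0_pauli_strings, of c] assms(2)
  by (auto simp: pauli_mat_replicate_0 left_mult_one_mat[OF pauli_state_carrier])

text \<open>\<open>P\<close> is a Hermitian involution, hence an isometry, and |<v, Pv>| is at most
  the mean of |v|^2 and |Pv|^2. This gives positivity of \<open>pauli_state\<close>.\<close>

lemma pauli_mat_quadratic_form:
  fixes v :: "nat \<Rightarrow> complex"
  shows "\<bar>Re (\<Sum>i<2^n. \<Sum>j<2^n. cnj (v i) * pauli_mat n s $$ (i,j) * v j)\<bar> \<le> (\<Sum>i<2^n. (cmod (v i))\<^sup>2)"
proof -
  let ?P = "\<lambda>i j. pauli_mat n s $$ (i,j)"
  define w where "w i = (\<Sum>j<2^n. ?P i j * v j)" for i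
  have "of_real (\<Sum>i<2^n. (cmod (w i))\<^sup>2) = (\<Sum>i<2^n. cnj (w i) * w i)"
    by (simp add: complex_norm_square mult.commute del: of_real_power)
  also have "\<dots> = (\<Sum>i<2^n. \<Sum>k<2^n. \<Sum>j<2^n. cnj (v k) * v j * (?P k i * ?P i j))"
    unfolding w_def cnj_sum sum_distrib_right unfolding sum_distrib_left
    by (intro sum.cong refl) (simp add: cnj_pauli_mat mult_ac)
  also have "\<dots> = (\<Sum>k<2^n. \<Sum>j<2^n. cnj (v k) * v j * (\<Sum>i<2^n. ?P k i * ?P i j))"
    unfolding sum_distrib_left
    by (subst sum.swap, rule sum.cong[OF refl], subst sum.swap) (rule refl)
  also have "\<dots> = (\<Sum>k<2^n. \<Sum>j<2^n. if j = k then cnj (v k) * v k else 0)"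
    by (intro sum.cong refl) (auto simp: pauli_mat_involution)
  also have "\<dots> = of_real (\<Sum>i<2^n. (cmod (v i))\<^sup>2)"
    by (simp add: complex_norm_square mult.commute del: of_real_power)
  finally have norm_w: "(\<Sum>i<2^n. (cmod (w i))\<^sup>2) = (\<Sum>i<2^n. (cmod (v i))\<^sup>2)"
    by (simp only: of_real_eq_iff)
  have Q: "Re (\<Sum>i<2^n. \<Sum>j<2^n. cnj (v i) * ?P i j * v j) = (\<Sum>i<2^n. Re (cnj (v i) * w i))"
    by (simp add: w_def sum_distrib_left mult.assoc del: times_complex.sel)
  have "2 * \<bar>Re (cnj x * y)\<bar> \<le> (cmod x)\<^sup>2 + (cmod y)\<^sup>2" for x y :: complex
  proof -
    have "\<bar>Re (cnj x * y)\<bar> \<le> cmod x * cmod y"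
      using abs_Re_le_cmod[of "cnj x * y"] by (simp add: norm_mult)
    then show ?thesis using sum_squares_bound[of "cmod x" "cmod y"] by linarith
  qed
  then have "(\<Sum>i<2^n. 2 * \<bar>Re (cnj (v i) * w i)\<bar>) \<le> (\<Sum>i<2^n. (cmod (v i))\<^sup>2 + (cmod (w i))\<^sup>2)"
    by (intro sum_mono)
  then have "2 * \<bar>\<Sum>i<2^n. Re (cnj (v i) * w i)\<bar> \<le> (\<Sum>i<2^n. (cmod (v i))\<^sup>2 + (cmod (w i))\<^sup>2)"
    using sum_abs[of "\<lambda>i. Re (cnj (v i) * w i)" "{..<2^n}"]
    unfolding sum_distrib_left[symmetric] by linarith
  then show ?thesis unfolding Q sum.distrib norm_w by simp
qed

lemma density_matrix_pauli_state:
  assumes "s \<in> pauli_strings n" "c = 0 \<or> s \<noteq> replicate n 0" "\<bar>c\<bar> \<le> 1"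
  shows "density_matrix n (pauli_state n c s)"
  unfolding density_matrix_def
proof (intro conjI allI)
  show "adj (pauli_state n c s) = pauli_state n c s"
    by (rule eq_matI) (auto simp: adj_def pauli_state_def cnj_pauli_mat)
next
  fix v :: "nat \<Rightarrow> complex"
  let ?P = "\<lambda>i j. pauli_mat n s $$ (i,j)"
  let ?V = "\<Sum>i<2^n. (cmod (v i))\<^sup>2" and ?Q = "\<Sum>i<2^n. \<Sum>j<2^n. cnj (v i) * ?P i j * v j"
  have "(\<Sum>i<2^n. \<Sum>j<2^n. cnj (v i) * pauli_state n c s $$ (i,j) * v j)
      = (\<Sum>i<2^n. \<Sum>j<2^n. ((if j = i then cnj (v i) * v i else 0) + of_real c * (cnj (v i) * ?P i j * v j)) / 2^n)"
    by (intro sum.cong refl) (auto simp: pauli_state_index algebra_simps add_divide_distrib)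
  also have "\<dots> = ((\<Sum>i<2^n. cnj (v i) * v i) + of_real c * ?Q) / 2^n"
    unfolding sum_divide_distrib[symmetric] sum.distrib sum_distrib_left[symmetric] by simp
  also have "(\<Sum>i<2^n. cnj (v i) * v i) = of_real ?V"
    by (simp add: complex_norm_square mult.commute del: of_real_power)
  also have "Re ((of_real ?V + of_real c * ?Q) / 2^n) = (?V + c * Re ?Q) / 2^n"
    using Re_divide_of_real[of "of_real ?V + of_real c * ?Q" "2^n"] by (simp del: Re_sum of_real_sum)
  moreover have "\<bar>c * Re ?Q\<bar> \<le> ?V"
    using mult_mono[OF assms(3) pauli_mat_quadratic_form[where v = v and n = n and s = s]]
    by (simp add: abs_mult del: Re_sum)
  ultimately show "0 \<le> Re (\<Sum>i<2^n. \<Sum>j<2^n. cnj (v i) * pauli_state n c s $$ (i,j) * v j)"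
    by (simp del: Re_sum)
qed (use assms mtrace_pauli_state in auto)

text \<open>The difference is \<open>- 2 * a / 2^n\<close> times a unitary, so all
  \<open>2^n\<close> singular values equal \<open>2 * a / 2^n\<close>.\<close>

lemma trace_norm_pauli_state_diff:
  assumes "0 \<le> a"
  shows "trace_norm (pauli_state n (-a) s - pauli_state n a s) = 2 * a"
proof -
  define A where "A = pauli_state n (-a) s - pauli_state n a s"
  define c where "c = (2 * a / 2^n)\<^sup>2"
  have A: "A \<in> carrier_mat (2^n) (2^n)" unfolding A_def by (intro minus_carrier_mat) simp
  have idx: "A $$ (i,j) = of_real (- 2 * a / 2^n) * pauli_mat n s $$ (i,j)" if "i < 2^n" "j < 2^n" for i j
    using that unfolding A_def by (subst index_minus_mat) (auto simp: pauli_state_def field_simps)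
  have "adj A * A = of_real c \<cdot>\<^sub>m 1\<^sub>m (2^n)"
  proof (rule eq_matI)
    fix i l assume "i < dim_row (of_real c \<cdot>\<^sub>m 1\<^sub>m (2^n) :: complex mat)" "l < dim_col (of_real c \<cdot>\<^sub>m 1\<^sub>m (2^n) :: complex mat)"
    then have il: "i < 2^n" "l < 2^n" by auto
    have "(adj A * A) $$ (i,l) = (\<Sum>j<2^n. cnj (A $$ (j,i)) * A $$ (j,l))"
      using A il by (simp add: scalar_prod_def adj_def atLeast0LessThan)
    also have "\<dots> = (\<Sum>j<2^n. of_real c * (pauli_mat n s $$ (i,j) * pauli_mat n s $$ (j,l)))"
      using il by (intro sum.cong refl) (simp add: idx cnj_pauli_mat c_def power2_eq_square)
    also have "\<dots> = of_real c * (if i = l then 1 else 0)"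
      unfolding sum_distrib_left[symmetric] pauli_mat_involution[OF il] ..
    finally show "(adj A * A) $$ (i,l) = (of_real c \<cdot>\<^sub>m 1\<^sub>m (2^n)) $$ (i,l)" using il by simp
  qed (use A in \<open>auto simp: adj_def\<close>)
  moreover have "char_poly (of_real c \<cdot>\<^sub>m 1\<^sub>m (2^n) :: complex mat) = [:- of_real c, 1:] ^ 2^n"
  proof (subst char_poly_upper_triangular)
    have "diag_mat (of_real c \<cdot>\<^sub>m 1\<^sub>m (2^n) :: complex mat) = replicate (2^n) (of_real c)"
      by (auto simp: diag_mat_def list_eq_iff_nth_eq)
    then show "(\<Prod>a\<leftarrow>diag_mat (of_real c \<cdot>\<^sub>m 1\<^sub>m (2^n)). [:- a, 1:]) = [:- complex_of_real c, 1:] ^ 2^n"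
      by simp
  qed (auto simp: upper_triangular_def)
  moreover have "(\<Sum>z\<in>#repeat_mset N {#x#}. f z) = real N * f x" for N and x :: complex and f :: "complex \<Rightarrow> real"
    by (induction N) (auto simp: algebra_simps)
  ultimately have "trace_norm A = 2^n * sqrt c"
    by (simp add: trace_norm_def proots_power del: of_real_power)
  then show ?thesis using assms by (simp add: c_def A_def)
qed

section \<open>Expected query counts and relative entropy\<close>

text \<open>The expected number of queries of \<open>s\<close> among the next \<open>k\<close>, on
  copies of either kind, when both unknown states are \<open>\<mu>\<close>.\<close>

fun expected_hits :: "nat \<Rightarrow> tester \<Rightarrow> complex mat \<Rightarrow> nat list \<Rightarrow> nat \<Rightarrow> history \<Rightarrow> real" where
  "expected_hits n T \<mu> s 0 h = 0"
| "expected_hits n T \<mu> s (Suc k) h =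
     (\<Sum>q\<in>queries n. fst T h q *
        ((if snd q = s then 1 else 0) +
         (\<Sum>b\<in>(UNIV::bool set).
           pauli_outcome_prob n \<mu> (snd q) b *
           expected_hits n T \<mu> s k (h @ [(fst q, snd q, b)]))))"

lemma finite_queries [simp]: "finite (queries n)"
  by (simp add: queries_def)

lemma sum_pauli_outcome_prob:
  assumes "\<rho> \<in> carrier_mat (2^n) (2^n)" "mtrace \<rho> = 1"
  shows "(\<Sum>b\<in>(UNIV::bool set). pauli_outcome_prob n \<rho> s b) = 1"
  by (simp add: UNIV_bool pauli_outcome_prob_eq[OF assms] field_simps)

text \<open>Each query uses exactly one string, so lower bounds on the separate counts add up to a
  lower bound on the number of copies.\<close>

lemma sum_expected_hits:
  assumes T: "valid_tester n T" and \<mu>: "\<mu> \<in> carrier_mat (2^n) (2^n)" "mtrace \<mu> = 1"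
  shows "(\<Sum>s\<in>pauli_strings n. expected_hits n T \<mu> s k h) = real k"
proof (induction k arbitrary: h)
  case (Suc k)
  have "(\<Sum>s\<in>pauli_strings n. expected_hits n T \<mu> s (Suc k) h)
      = (\<Sum>q\<in>queries n. fst T h q * ((\<Sum>s\<in>pauli_strings n. if snd q = s then 1 else 0) +
          (\<Sum>b\<in>UNIV. pauli_outcome_prob n \<mu> (snd q) b *
             (\<Sum>s\<in>pauli_strings n. expected_hits n T \<mu> s k (h @ [(fst q, snd q, b)])))))"
    unfolding expected_hits.simps
    by (subst sum.swap)
       (simp add: UNIV_bool sum.distrib sum_distrib_left[symmetric])
  also have "\<dots> = (\<Sum>q\<in>queries n. fst T h q * (1 + real k))"
  proof (intro sum.cong refl)
    fix q assume "q \<in> queries n"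
    then have "(\<Sum>s\<in>pauli_strings n. if snd q = s then 1 else 0) = (1::real)"
      by (auto simp: queries_def)
    then show "fst T h q * ((\<Sum>s\<in>pauli_strings n. if snd q = s then 1 else 0) +
          (\<Sum>b\<in>UNIV. pauli_outcome_prob n \<mu> (snd q) b *
             (\<Sum>s\<in>pauli_strings n. expected_hits n T \<mu> s k (h @ [(fst q, snd q, b)]))))
        = fst T h q * (1 + real k)"
      by (simp add: Suc sum_distrib_right[symmetric] sum_pauli_outcome_prob[OF \<mu>])
  qed
  also have "\<dots> = real (Suc k)"
    using T by (simp add: sum_distrib_right[symmetric] valid_tester_def)
  finally show ?case .
qed simp

text \<open>Averaging over the random query: reduces the induction step of the likelihood bound to a
  fixed query.\<close>

lemma convex_combination_le:
  fixes w :: "'a \<Rightarrow> real"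
  assumes "\<And>q. q \<in> Q \<Longrightarrow> 0 \<le> w q" "sum w Q = 1"
    and "\<And>q. q \<in> Q \<Longrightarrow> c0 + c1 * F q - c2 * X q \<le> d0 + d1 * G q"
  shows "c0 + c1 * (\<Sum>q\<in>Q. w q * F q) - c2 * (\<Sum>q\<in>Q. w q * X q) \<le> d0 + d1 * (\<Sum>q\<in>Q. w q * G q)"
proof -
  have "(\<Sum>q\<in>Q. w q * (c0 + c1 * F q - c2 * X q)) \<le> (\<Sum>q\<in>Q. w q * (d0 + d1 * G q))"
    using assms by (intro sum_mono mult_left_mono) auto
  moreover have "(\<Sum>q\<in>Q. w q * (c0 + c1 * F q - c2 * X q))
     = sum w Q * c0 + c1 * (\<Sum>q\<in>Q. w q * F q) - c2 * (\<Sum>q\<in>Q. w q * X q)"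
    unfolding distrib_left right_diff_distrib sum.distrib sum_subtractf sum_distrib_left sum_distrib_right
    by (simp add: mult_ac)
  moreover have "(\<Sum>q\<in>Q. w q * (d0 + d1 * G q)) = sum w Q * d0 + d1 * (\<Sum>q\<in>Q. w q * G q)"
    unfolding distrib_left sum.distrib sum_distrib_left sum_distrib_right by (simp add: mult_ac)
  ultimately show ?thesis using assms(2) by simp
qed

text \<open>A variational form of the data-processing inequality for the relative entropy: the
  parameter \<open>l\<close> is the likelihood ratio accumulated so far, and a single query of \<open>s\<close> costs
  at most the relative entropy of a fair coin with respect to a coin of bias \<open>a\<close>.\<close>

lemma accept_prob_likelihood_bound:
  assumes T: "valid_tester n T" and s: "s \<in> pauli_strings n" "s \<noteq> replicate n 0"
    and a: "0 \<le> a" "a < 1" and "0 < l"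
  shows "(ln l + 1 - ln 2) + (2 * ln 2) * accept_prob n T (pauli_state n 0 s) (pauli_state n 0 s) k h
         - (- (ln (1 + a) + ln (1 - a)) / 2) * expected_hits n T (pauli_state n 0 s) s k h
       \<le> l / 2 + (3 / 2 * l) * accept_prob n T (pauli_state n (-a) s) (pauli_state n a s) k h"
  using \<open>0 < l\<close>
proof (induction k arbitrary: h l)
  case 0
  define z where "z = snd T h"
  have z: "0 \<le> z" "z \<le> 1" using T by (auto simp: z_def valid_tester_def)
  \<comment> \<open>The factors 2 and 1/2 are the null-to-alternative likelihood ratios of the two
    verdicts when acceptance has probability 2/3 and 1/3; there the bound is tight.\<close>
  have "ln (2 * l) \<le> 2 * l - 1" "ln (l / 2) \<le> l / 2 - 1"
    using 0 by (auto intro!: ln_le_minus_one)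
  then have "ln 2 + ln l \<le> 2 * l - 1" "ln l - ln 2 \<le> l / 2 - 1"
    using 0 by (auto simp: ln_mult ln_div)
  then have "z * (ln 2 + ln l) + (1 - z) * (ln l - ln 2) \<le> z * (2 * l - 1) + (1 - z) * (l / 2 - 1)"
    using z by (intro add_mono mult_left_mono) auto
  then show ?case by (simp add: z_def[symmetric] field_simps)
next
  case (Suc k)
  let ?\<mu> = "pauli_state n 0 s" and ?\<rho> = "pauli_state n (-a) s" and ?\<sigma> = "pauli_state n a s"
  define \<kappa> where "\<kappa> = - (ln (1 + a) + ln (1 - a)) / 2"
  define p0 p1 where "p0 q b = pauli_outcome_prob n (if fst q then ?\<mu> else ?\<mu>) (snd q) b"
    and "p1 q b = pauli_outcome_prob n (if fst q then ?\<rho> else ?\<sigma>) (snd q) b" for q :: "bool \<times> nat list" and b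
  define f0 f1 H where "f0 h' = accept_prob n T ?\<mu> ?\<mu> k h'" and "f1 h' = accept_prob n T ?\<rho> ?\<sigma> k h'"
    and "H h' = expected_hits n T ?\<mu> s k h'" for h'
  note IH = Suc.IH[folded \<kappa>_def f0_def f1_def H_def]
  have "(ln l + 1 - ln 2) + (2 * ln 2) * (\<Sum>q\<in>queries n. fst T h q * (\<Sum>b\<in>UNIV. p0 q b * f0 (h @ [(fst q, snd q, b)])))
         - \<kappa> * (\<Sum>q\<in>queries n. fst T h q * ((if snd q = s then 1 else 0) + (\<Sum>b\<in>UNIV. p0 q b * H (h @ [(fst q, snd q, b)]))))
       \<le> l / 2 + (3 / 2 * l) * (\<Sum>q\<in>queries n. fst T h q * (\<Sum>b\<in>UNIV. p1 q b * f1 (h @ [(fst q, snd q, b)])))"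
  proof (rule convex_combination_le)
    fix q assume q: "q \<in> queries n"
    then have t: "snd q \<in> pauli_strings n" by (auto simp: queries_def)
    \<comment> \<open>\<open>u\<close> is the null probability of outcome \<open>True\<close>; the
      alternative multiplies the outcome probabilities by \<open>1 + e\<close> and
      \<open>1 - e\<close>. For the identity string, \<open>u = 1\<close> and
      \<open>e = 0\<close>.\<close>
    define e where "e = (if snd q = s then if fst q then -a else a else 0)"
    define u where "u = (if snd q = replicate n 0 then 1 else 1/2 :: real)"
    have p: "p0 q True = u" "p0 q False = 1 - u" "p1 q True = u * (1 + e)" "p1 q False = (1 - u) * (1 - e)"
    proof -
      have pr: "pauli_outcome_prob n (pauli_state n c s) (snd q) b = (1 + (if b then 1 else -1) *
          ((if snd q = replicate n 0 then 1 else 0) + c * (if snd q = s then 1 else 0))) / 2" for c b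
        unfolding pauli_coeff_pauli_state[OF s(1) t, symmetric]
        by (intro pauli_outcome_prob_eq pauli_state_carrier mtrace_pauli_state s disjI2)
      show "p0 q True = u" "p0 q False = 1 - u" by (simp_all add: p0_def pr u_def)
      have "(if fst q then ?\<rho> else ?\<sigma>) = pauli_state n (if fst q then -a else a) s" by simp
      then have p1: "p1 q b = (1 + (if b then 1 else -1) *
          ((if snd q = replicate n 0 then 1 else 0) + e)) / 2" for b
        unfolding p1_def e_def by (simp only: pr) simp
      have "snd q = replicate n 0 \<Longrightarrow> e = 0" using s(2) by (simp add: e_def)
      then show "p1 q True = u * (1 + e)" "p1 q False = (1 - u) * (1 - e)"
        unfolding p1 u_def by simp_all
    qed
    have u: "0 \<le> u" "u \<le> 1" by (auto simp: u_def)
    have e: "0 < 1 + e" "0 < 1 - e" using a by (auto simp: e_def)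
    \<comment> \<open>The expected logarithm of the likelihood ratio under the null state: only
      queries of \<open>s\<close> cost anything.\<close>
    have lnb: "u * ln (1 + e) + (1 - u) * ln (1 - e) = - \<kappa> * (if snd q = s then 1 else 0)"
      using s(2) by (cases "snd q = s"; cases "fst q") (simp_all add: u_def e_def \<kappa>_def field_simps)
    let ?h = "\<lambda>b. h @ [(fst q, snd q, b)]"
    \<comment> \<open>The induction hypothesis is used with \<open>l\<close> multiplied by the
      likelihood ratio of the outcome.\<close>
    have "u * ((ln (l * (1 + e)) + 1 - ln 2) + 2 * ln 2 * f0 (?h True) - \<kappa> * H (?h True))
        + (1 - u) * ((ln (l * (1 - e)) + 1 - ln 2) + 2 * ln 2 * f0 (?h False) - \<kappa> * H (?h False))
        \<le> u * ((l * (1 + e)) / 2 + 3 / 2 * (l * (1 + e)) * f1 (?h True))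
        + (1 - u) * ((l * (1 - e)) / 2 + 3 / 2 * (l * (1 - e)) * f1 (?h False))"
      using Suc.prems u e by (intro add_mono mult_left_mono IH) auto
    also have "ln (l * (1 + e)) = ln l + ln (1 + e)" using Suc.prems e by (simp add: ln_mult)
    also have "ln (l * (1 - e)) = ln l + ln (1 - e)" using Suc.prems e by (simp add: ln_mult)
    also have "u * ((l * (1 + e)) / 2 + 3 / 2 * (l * (1 + e)) * f1 (?h True))
        + (1 - u) * ((l * (1 - e)) / 2 + 3 / 2 * (l * (1 - e)) * f1 (?h False))
        = l / 2 * (u * (1 + e) + (1 - u) * (1 - e))
        + (3 / 2 * l) * ((u * (1 + e)) * f1 (?h True) + ((1 - u) * (1 - e)) * f1 (?h False))"
      by (simp add: field_simps)
    also have "u * (1 + e) + (1 - u) * (1 - e) = 1"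
      using s(2) by (cases "snd q = s") (simp_all add: u_def e_def field_simps)
    finally have ineq: "u * ((ln l + ln (1 + e) + 1 - ln 2) + 2 * ln 2 * f0 (?h True) - \<kappa> * H (?h True))
        + (1 - u) * ((ln l + ln (1 - e) + 1 - ln 2) + 2 * ln 2 * f0 (?h False) - \<kappa> * H (?h False))
        \<le> l / 2 * 1 + (3 / 2 * l) * ((u * (1 + e)) * f1 (?h True) + ((1 - u) * (1 - e)) * f1 (?h False))" .
    have "u * ((ln l + ln (1 + e) + 1 - ln 2) + 2 * ln 2 * f0 (?h True) - \<kappa> * H (?h True))
        + (1 - u) * ((ln l + ln (1 - e) + 1 - ln 2) + 2 * ln 2 * f0 (?h False) - \<kappa> * H (?h False))
        = (ln l + 1 - ln 2) + (u * ln (1 + e) + (1 - u) * ln (1 - e))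
          + (2 * ln 2) * (u * f0 (?h True) + (1 - u) * f0 (?h False))
          - \<kappa> * (u * H (?h True) + (1 - u) * H (?h False))"
      by (simp add: algebra_simps)
    with ineq lnb show "(ln l + 1 - ln 2) + (2 * ln 2) * (\<Sum>b\<in>UNIV. p0 q b * f0 (?h b))
         - \<kappa> * ((if snd q = s then 1 else 0) + (\<Sum>b\<in>UNIV. p0 q b * H (?h b)))
       \<le> l / 2 + (3 / 2 * l) * (\<Sum>b\<in>UNIV. p1 q b * f1 (?h b))"
      by (simp add: UNIV_bool p add.commute distrib_left[of \<kappa>])
  qed (use T in \<open>auto simp: valid_tester_def\<close>)
  then show ?case by (simp add: p0_def p1_def f0_def f1_def H_def \<kappa>_def)
qed

text \<open>The logarithms add up to \<open>ln (1 - a\<^sup>2)\<close>, and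
  \<open>1 - a\<^sup>2 \<ge> 7/16\<close> yields the constant 8/7.\<close>

lemma minus_ln_one_minus_square_le:
  fixes a :: real
  assumes "0 \<le> a" "a\<^sup>2 \<le> 9/16"
  shows "- (ln (1 + a) + ln (1 - a)) / 2 \<le> 8/7 * a\<^sup>2"
proof -
  have "a < 1" using assms(2) by (intro power2_less_imp_less[of a 1]) auto
  have pos: "0 < 1 - a\<^sup>2" using assms by simp
  have "- (ln (1 + a) + ln (1 - a)) = - ln (1 - a\<^sup>2)"
    using \<open>a < 1\<close> assms ln_mult[of "1 + a" "1 - a"] by (simp add: algebra_simps power2_eq_square)
  also have "\<dots> = ln (1 / (1 - a\<^sup>2))" using pos by (simp add: ln_div)
  also have "\<dots> \<le> 1 / (1 - a\<^sup>2) - 1" using pos by (intro ln_le_minus_one) simp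
  also have "\<dots> = a\<^sup>2 / (1 - a\<^sup>2)" using pos by (simp add: field_simps)
  also have "\<dots> \<le> a\<^sup>2 / (7/16)" using assms by (intro divide_left_mono) auto
  finally show ?thesis by simp
qed

theorem pauli_closeness_lower_bound:
  assumes n: "n \<ge> 1" and \<epsilon>: "0 < \<epsilon>" "\<epsilon> \<le> 1" and T: "pauli_closeness_tester n \<epsilon> m T"
  shows "real m \<ge> 1/8 * 4^n / \<epsilon>\<^sup>2"
proof -
  \<comment> \<open>The trace distance \<open>2 * a\<close> is 3/2 times \<open>\<epsilon>\<close>,
    hence large enough, while \<open>a \<le> 3/4\<close> keeps the states positive and
    \<open>\<kappa>\<close> of order \<open>a\<^sup>2\<close>.\<close>
  define a where "a = 3/4 * \<epsilon>"
  define \<kappa> where "\<kappa> = - (ln (1 + a) + ln (1 - a)) / 2"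
  let ?I = "replicate n 0" and ?\<mu> = "pauli_state n 0 (replicate n 0)"
  let ?H = "\<lambda>s. expected_hits n T ?\<mu> s m []"
  have valid: "valid_tester n T" using T by (simp add: pauli_closeness_tester_def)
  have "\<epsilon>\<^sup>2 \<le> 1" using \<epsilon> by (simp add: power_le_one)
  then have a: "0 \<le> a" "a < 1" "a\<^sup>2 \<le> 9/16" using \<epsilon> by (auto simp: a_def power_mult_distrib power2_eq_square)
  \<comment> \<open>For \<open>l = 1\<close> the likelihood bound reads
    \<open>1 - ln 2 + 4/3 * ln 2 - \<kappa> * ?H s \<le> 1\<close>, so
    \<open>\<kappa> * ?H s\<close> is at least \<open>ln 2 / 3\<close>, and
    \<open>ln 2 \<ge> 1/2\<close>.\<close>
  have hit: "1/6 \<le> \<kappa> * ?H s" if s: "s \<in> pauli_strings n" "s \<noteq> ?I" for s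
  proof -
    have \<mu>: "pauli_state n 0 s = ?\<mu>" by (simp add: pauli_state_def)
    have dens: "density_matrix n ?\<mu>" "density_matrix n (pauli_state n (-a) s)" "density_matrix n (pauli_state n a s)"
      using s a by (auto intro!: density_matrix_pauli_state simp: replicate_0_pauli_strings)
    have "trace_norm (pauli_state n (-a) s - pauli_state n a s) > \<epsilon>"
      unfolding trace_norm_pauli_state_diff[OF a(1)] using \<epsilon> by (simp add: a_def)
    then have acc: "accept_prob n T ?\<mu> ?\<mu> m [] \<ge> 2/3"
      "accept_prob n T (pauli_state n (-a) s) (pauli_state n a s) m [] \<le> 1/3"
      using T dens unfolding pauli_closeness_tester_def by force+
    have ln2: "1/2 \<le> ln (2::real)" using ln_le_minus_one[of "1/2::real"] by (simp add: ln_div)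
    have "2 * ln 2 * (2/3) \<le> 2 * ln 2 * accept_prob n T ?\<mu> ?\<mu> m []"
      using acc ln2 by (intro mult_left_mono) auto
    with accept_prob_likelihood_bound[OF valid s a(1,2), of 1 m "[]", folded \<kappa>_def] acc(2) ln2
    show ?thesis unfolding \<mu> ln_one by linarith
  qed
  have \<kappa>0: "0 \<le> \<kappa>"
  proof -
    have "ln (1 + a) \<le> a" "ln (1 - a) \<le> - a"
      using ln_le_minus_one[of "1 + a"] ln_le_minus_one[of "1 - a"] a by auto
    then show ?thesis by (simp add: \<kappa>_def)
  qed
  \<comment> \<open>\<open>hit\<close> leaves out the identity string; its nonnegative count may be
    added to the sum.\<close>
  have nn: "0 \<le> \<kappa> * ?H ?I"
  proof -
    have "0 \<le> expected_hits n T ?\<mu> ?I k h" for k h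
    proof (induction k arbitrary: h)
      case (Suc k)
      have "0 \<le> pauli_outcome_prob n ?\<mu> t b" if "t \<in> pauli_strings n" for t b
        using that by (auto simp: pauli_outcome_prob_eq mtrace_pauli_state replicate_0_pauli_strings
            pauli_coeff_pauli_state)
      then show ?case using Suc valid
        by (auto simp: valid_tester_def queries_def intro!: sum_nonneg mult_nonneg_nonneg add_nonneg_nonneg)
    qed simp
    then show ?thesis using \<kappa>0 by simp
  qed
  have "(4^n - 1) * (1/6) = (\<Sum>s\<in>pauli_strings n - {?I}. 1/6 :: real)"
    by (simp add: card_Diff_singleton replicate_0_pauli_strings card_pauli_strings)
  also have "\<dots> \<le> (\<Sum>s\<in>pauli_strings n - {?I}. \<kappa> * ?H s)"
    using hit by (intro sum_mono) auto
  also have "\<dots> \<le> (\<Sum>s\<in>pauli_strings n. \<kappa> * ?H s)"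
    using nn by (simp add: sum_diff1 replicate_0_pauli_strings)
  also have "\<dots> = \<kappa> * real m"
    using sum_expected_hits[OF valid, of ?\<mu> m "[]"]
    by (simp add: sum_distrib_left[symmetric] mtrace_pauli_state replicate_0_pauli_strings)
  also have "\<dots> \<le> 8/7 * a\<^sup>2 * real m"
    using minus_ln_one_minus_square_le[OF a(1,3)] by (intro mult_right_mono) (auto simp: \<kappa>_def)
  also have "\<dots> = 9/14 * (\<epsilon>\<^sup>2 * real m)" by (simp add: a_def power2_eq_square)
  finally have "(4^n - 1) * (1/6) \<le> 9/14 * (\<epsilon>\<^sup>2 * real m)" .
  \<comment> \<open>Makes \<open>4^n - 1\<close> at least three quarters of
    \<open>4^n\<close>.\<close>
  moreover have "(4::real) \<le> 4^n" using n power_increasing[of 1 n "4::real"] by simp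
  ultimately have "4^n \<le> 8 * (\<epsilon>\<^sup>2 * real m)" by argo
  then show ?thesis using \<epsilon> by (simp add: field_simps)
qed

section \<open>Random walks\<close>

text \<open>\<open>walk_expectation \<mu> F k t x\<close> is the expectation of \<open>F\<close> after \<open>k\<close> further steps of a
  \<open>\<plusminus>1\<close> walk that stands at \<open>x\<close> at time \<open>t\<close> and whose step at time \<open>t\<close> has mean \<open>\<mu> t\<close>.\<close>

fun walk_expectation :: "(nat \<Rightarrow> real) \<Rightarrow> (real \<Rightarrow> real) \<Rightarrow> nat \<Rightarrow> nat \<Rightarrow> real \<Rightarrow> real" where
  "walk_expectation \<mu> F 0 t x = F x"
| "walk_expectation \<mu> F (Suc k) t x =
     (1 + \<mu> t) / 2 * walk_expectation \<mu> F k (Suc t) (x + 1) +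
     (1 - \<mu> t) / 2 * walk_expectation \<mu> F k (Suc t) (x - 1)"

lemma walk_expectation_mono:
  assumes "\<And>t. \<bar>\<mu> t\<bar> \<le> 1" "\<And>x. F x \<le> G x"
  shows "walk_expectation \<mu> F k t x \<le> walk_expectation \<mu> G k t x"
proof (induction k arbitrary: t x)
  case (Suc k)
  have "0 \<le> (1 + \<mu> t) / 2" "0 \<le> (1 - \<mu> t) / 2" using assms(1)[of t] by auto
  then show ?case using Suc by (auto intro!: add_mono mult_left_mono)
qed (use assms in simp)

lemma walk_expectation_linear:
  "walk_expectation \<mu> (\<lambda>x. a + b * F x + c * G x) k t x
   = a + b * walk_expectation \<mu> F k t x + c * walk_expectation \<mu> G k t x"
proof (induction k arbitrary: t x)
  case (Suc k)
  have "(1 + m) / 2 * (a + b * f1 + c * g1) + (1 - m) / 2 * (a + b * f2 + c * g2)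
     = a + b * ((1 + m) / 2 * f1 + (1 - m) / 2 * f2) + c * ((1 + m) / 2 * g1 + (1 - m) / 2 * g2)"
    for m f1 f2 g1 g2 :: real by (simp add: field_simps)
  then show ?case by (simp only: walk_expectation.simps Suc)
qed simp

lemma walk_expectation_const: "walk_expectation \<mu> (\<lambda>x. c) k t x = c"
  by (induction k arbitrary: t x) (simp_all add: field_simps)

lemma walk_expectation_indicator_bounds:
  assumes "\<And>t. \<bar>\<mu> t\<bar> \<le> 1"
  shows "0 \<le> walk_expectation \<mu> (\<lambda>x. if P x then 1 else 0) k t x"
    "walk_expectation \<mu> (\<lambda>x. if P x then 1 else 0) k t x \<le> 1"
  using walk_expectation_mono[of \<mu> "\<lambda>x. 0" "\<lambda>x. if P x then 1 else 0" k t x]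
    walk_expectation_mono[of \<mu> "\<lambda>x. if P x then 1 else 0" "\<lambda>x. 1" k t x] assms
  by (simp_all add: walk_expectation_const)

text \<open>The steps are independent, and \<open>cosh \<beta> + m * sinh \<beta>\<close> is the
  moment generating function of a sign with mean \<open>m\<close>.\<close>

lemma walk_expectation_exp:
  "walk_expectation \<mu> (\<lambda>x. exp (\<beta> * x)) k t x
   = exp (\<beta> * x) * (\<Prod>i<k. cosh \<beta> + \<mu> (t + i) * sinh \<beta>)"
proof (induction k arbitrary: t x)
  case (Suc k)
  have step: "(1 + \<mu> t) / 2 * exp (\<beta> * (x + 1)) + (1 - \<mu> t) / 2 * exp (\<beta> * (x - 1))
      = exp (\<beta> * x) * (cosh \<beta> + \<mu> t * sinh \<beta>)"
    by (simp add: cosh_def sinh_def exp_add exp_diff exp_minus field_simps)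
  have "(1 + \<mu> t) / 2 * (exp (\<beta> * (x + 1)) * p) + (1 - \<mu> t) / 2 * (exp (\<beta> * (x - 1)) * p)
      = exp (\<beta> * x) * ((cosh \<beta> + \<mu> t * sinh \<beta>) * p)" for p
    unfolding mult.assoc[symmetric] distrib_right[symmetric] step ..
  then show ?case
    by (simp add: Suc prod.lessThan_Suc_shift del: prod.lessThan_Suc)
qed simp

text \<open>Squared bias plus variance; the step at time \<open>t\<close> has variance
  \<open>1 - (\<mu> t)\<^sup>2 \<le> 1\<close>.\<close>

lemma walk_expectation_square:
  assumes "\<And>t. \<bar>\<mu> t\<bar> \<le> 1"
  shows "walk_expectation \<mu> (\<lambda>x. (x - c)\<^sup>2) k t x \<le> (x + (\<Sum>i<k. \<mu> (t + i)) - c)\<^sup>2 + real k"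
proof (induction k arbitrary: t x)
  case (Suc k)
  define S where "S = (\<Sum>i<k. \<mu> (Suc t + i))"
  have w: "0 \<le> (1 + \<mu> t) / 2" "0 \<le> (1 - \<mu> t) / 2" using assms[of t] by auto
  have "walk_expectation \<mu> (\<lambda>x. (x - c)\<^sup>2) (Suc k) t x
     \<le> (1 + \<mu> t) / 2 * ((x + 1 + S - c)\<^sup>2 + real k) + (1 - \<mu> t) / 2 * ((x - 1 + S - c)\<^sup>2 + real k)"
    using w Suc[of "Suc t"] unfolding S_def walk_expectation.simps by (intro add_mono mult_left_mono)
  also have "\<dots> = (x + (\<mu> t + S) - c)\<^sup>2 + real k + (1 - (\<mu> t)\<^sup>2)"
    by (simp add: power2_eq_square field_simps)
  also have "\<dots> \<le> (x + (\<mu> t + S) - c)\<^sup>2 + real (Suc k)" by simp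
  also have "\<mu> t + S = (\<Sum>i<Suc k. \<mu> (t + i))"
    by (simp add: S_def sum.lessThan_Suc_shift del: sum.lessThan_Suc)
  finally show ?case .
qed simp

section \<open>Tail bounds for walks with alternating means\<close>

text \<open>Even times stand for measurements of \<open>\<rho>\<close>, odd times for measurements
  of \<open>\<sigma>\<close> with the outcome negated; each pair of steps drifts by
  \<open>r - s\<close>.\<close>

definition alternating_mean :: "real \<Rightarrow> real \<Rightarrow> nat \<Rightarrow> real" where
  "alternating_mean r s t = (if even t then r else - s)"

lemma abs_alternating_mean_le: "\<bar>r\<bar> \<le> 1 \<Longrightarrow> \<bar>s\<bar> \<le> 1 \<Longrightarrow> \<bar>alternating_mean r s t\<bar> \<le> 1"
  by (simp add: alternating_mean_def)

lemma sum_alternating_mean: "(\<Sum>i<2*k. alternating_mean r s i) = real k * (r - s)"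
  by (induction k) (auto simp: alternating_mean_def algebra_simps)

lemma prod_alternating_mean:
  "(\<Prod>i<2*k. C + alternating_mean r s i * S) = ((C + r * S) * (C - s * S)) ^ k"
  by (induction k) (auto simp: alternating_mean_def algebra_simps)

text \<open>Averaging \<open>exp y \<le> 1 + y + y\<^sup>2\<close> over \<open>x\<close> and
  \<open>-x\<close> cancels the linear terms.\<close>

lemma cosh_le_exp_square:
  fixes x :: real
  assumes "\<bar>x\<bar> \<le> 1"
  shows "cosh x \<le> exp (x\<^sup>2)"
proof -
  have ub: "exp y \<le> 1 + y + y\<^sup>2" if "\<bar>y\<bar> \<le> 1" for y :: real
  proof (cases "0 \<le> y")
    case True then show ?thesis using exp_bound[of y] that by simp
  next
    case False
    \<comment> \<open>For negative \<open>y\<close>, multiply the claim by \<open>exp (-y)\<close>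
      and use its quadratic Taylor polynomial as a lower bound.\<close>
    have "exp (-y) \<ge> 1 - y + (-y)\<^sup>2 / 2" using exp_lower_Taylor_quadratic[of "-y"] False by simp
    have "(1 + y + y\<^sup>2) * (1 - y + y\<^sup>2/2) = 1 + y\<^sup>2 / 2 - y^3 / 2 + y^4 / 2"
      by (simp add: power2_eq_square power3_eq_cube power4_eq_xxxx field_simps)
    moreover have "y^3 \<le> 0" using False by (simp add: power3_eq_cube mult_nonneg_nonpos2 zero_le_mult_iff mult_le_0_iff)
    moreover have "0 \<le> y\<^sup>2" "0 \<le> y^4" by simp_all
    ultimately have "1 \<le> (1 + y + y\<^sup>2) * (1 - y + y\<^sup>2/2)" by linarith
    also have "\<dots> \<le> (1 + y + y\<^sup>2) * exp (-y)"
      using \<open>exp (-y) \<ge> _\<close> that by (intro mult_left_mono) (auto intro: add_nonneg_nonneg)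
    finally show ?thesis by (simp add: exp_minus field_simps)
  qed
  have "cosh x \<le> 1 + x\<^sup>2"
    using ub[of x] ub[of "-x"] assms by (simp add: cosh_def)
  also have "\<dots> \<le> exp (x\<^sup>2)" by (rule exp_ge_add_one_self)
  finally show ?thesis .
qed

text \<open>Two-sided Chernoff bound with a free parameter. With equal coefficients a pair of steps
  has moment generating function \<open>(cosh l)\<^sup>2 - (r * sinh l)\<^sup>2\<close>, bounded
  uniformly in \<open>r\<close>.\<close>

lemma walk_null_tail:
  assumes r: "\<bar>r\<bar> \<le> 1" and \<beta>: "0 \<le> \<beta>" "\<beta> \<le> 1"
  shows "walk_expectation (alternating_mean r r) (\<lambda>x. if \<bar>x\<bar> < \<theta> then 1 else 0) (2*k) 0 0
       \<ge> 1 - 2 * exp (2 * real k * \<beta>\<^sup>2 - \<beta> * \<theta>)"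
proof -
  let ?\<mu> = "alternating_mean r r"
  have \<mu>: "\<bar>?\<mu> t\<bar> \<le> 1" for t using abs_alternating_mean_le[OF r r] .
  have mgf: "walk_expectation ?\<mu> (\<lambda>x. exp (l * x)) (2*k) 0 0 \<le> exp (2 * real k * \<beta>\<^sup>2)" if l: "\<bar>l\<bar> = \<beta>" for l
  proof -
    have l2: "l\<^sup>2 = \<beta>\<^sup>2" using l by (metis power2_abs)
    have nn: "0 \<le> (cosh l + r * sinh l) * (cosh l - r * sinh l)"
    proof -
      have "\<bar>r * sinh l\<bar> \<le> 1 * \<bar>sinh l\<bar>" unfolding abs_mult using r by (intro mult_right_mono) auto
      also have "\<bar>sinh l\<bar> \<le> cosh l"
        using abs_le_square_iff[of "sinh l" "cosh l"] by (simp add: sinh_square_eq)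
      finally show ?thesis by (intro mult_nonneg_nonneg) auto
    qed
    have "(cosh l + r * sinh l) * (cosh l - r * sinh l) \<le> (cosh l)\<^sup>2"
      using zero_le_square[of "r * sinh l"] by (simp add: algebra_simps power2_eq_square)
    also have "\<dots> \<le> (exp (l\<^sup>2))\<^sup>2" using l \<beta> by (intro power_mono cosh_le_exp_square) auto
    also have "\<dots> = exp (2 * \<beta>\<^sup>2)" by (simp add: l2 exp_double)
    finally have "((cosh l + r * sinh l) * (cosh l - r * sinh l)) ^ k \<le> exp (2 * \<beta>\<^sup>2) ^ k"
      using nn by (rule power_mono)
    then show ?thesis
      unfolding walk_expectation_exp add_0 prod_alternating_mean
      by (simp add: exp_of_nat_mult[symmetric] mult_ac)
  qed
  \<comment> \<open>The indicator is at least one minus two exponentials, one per tail, in the shape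
    of \<open>walk_expectation_linear\<close>.\<close>
  have pt: "1 + (- exp (- \<beta> * \<theta>)) * exp (\<beta> * x) + (- exp (- \<beta> * \<theta>)) * exp (-\<beta> * x)
      \<le> (if \<bar>x\<bar> < \<theta> then 1 else 0)" for x
  proof (cases "\<bar>x\<bar> < \<theta>")
    case False
    then have "\<theta> \<le> x \<or> \<theta> \<le> -x" by auto
    then have "\<beta> * \<theta> \<le> \<beta> * x \<or> \<beta> * \<theta> \<le> \<beta> * - x" using mult_left_mono[OF _ \<beta>(1)] by blast
    then have "1 \<le> exp (\<beta> * x - \<beta> * \<theta>) \<or> 1 \<le> exp (- \<beta> * x - \<beta> * \<theta>)" by auto
    then have "1 \<le> exp (\<beta> * x - \<beta> * \<theta>) + exp (- \<beta> * x - \<beta> * \<theta>)"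
      using exp_gt_zero[of "\<beta> * x - \<beta> * \<theta>"] exp_gt_zero[of "- \<beta> * x - \<beta> * \<theta>"] by linarith
    moreover have "exp (\<beta> * x - \<beta> * \<theta>) = exp (- \<beta> * \<theta>) * exp (\<beta> * x)"
      "exp (- \<beta> * x - \<beta> * \<theta>) = exp (- \<beta> * \<theta>) * exp (- \<beta> * x)"
      unfolding exp_add[symmetric] by (simp_all add: algebra_simps)
    ultimately show ?thesis using False by simp
  next
    case True
    have "0 \<le> exp (- \<beta> * \<theta>) * exp (\<beta> * x)" "0 \<le> exp (- \<beta> * \<theta>) * exp (- \<beta> * x)" by simp_all
    then have "1 + (- exp (- \<beta> * \<theta>)) * exp (\<beta> * x) + (- exp (- \<beta> * \<theta>)) * exp (-\<beta> * x) \<le> 1"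
      unfolding mult_minus_left[of "exp (- \<beta> * \<theta>)"] by linarith
    with True show ?thesis by (simp only: if_True)
  qed
  have "walk_expectation ?\<mu> (\<lambda>x. 1 + (- exp (- \<beta> * \<theta>)) * exp (\<beta> * x) + (- exp (- \<beta> * \<theta>)) * exp (-\<beta> * x)) (2*k) 0 0
     \<le> walk_expectation ?\<mu> (\<lambda>x. if \<bar>x\<bar> < \<theta> then 1 else 0) (2*k) 0 0"
    by (rule walk_expectation_mono[OF \<mu> pt])
  then have "1 + (- exp (- \<beta> * \<theta>)) * walk_expectation ?\<mu> (\<lambda>x. exp (\<beta> * x)) (2*k) 0 0
     + (- exp (- \<beta> * \<theta>)) * walk_expectation ?\<mu> (\<lambda>x. exp (-\<beta> * x)) (2*k) 0 0
     \<le> walk_expectation ?\<mu> (\<lambda>x. if \<bar>x\<bar> < \<theta> then 1 else 0) (2*k) 0 0"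
    by (simp only: walk_expectation_linear)
  moreover have "exp (- \<beta> * \<theta>) * walk_expectation ?\<mu> (\<lambda>x. exp (l * x)) (2*k) 0 0
      \<le> exp (2 * real k * \<beta>\<^sup>2 - \<beta> * \<theta>)" if "\<bar>l\<bar> = \<beta>" for l
  proof -
    have "exp (2 * real k * \<beta>\<^sup>2 - \<beta> * \<theta>) = exp (- \<beta> * \<theta>) * exp (2 * real k * \<beta>\<^sup>2)"
      by (simp add: exp_diff exp_minus field_simps)
    then show ?thesis using mgf[OF that] by simp
  qed
  from this[of \<beta>] this[of "-\<beta>"] \<beta> have "exp (- \<beta> * \<theta>) * walk_expectation ?\<mu> (\<lambda>x. exp (\<beta> * x)) (2*k) 0 0
      \<le> exp (2 * real k * \<beta>\<^sup>2 - \<beta> * \<theta>)" "exp (- \<beta> * \<theta>) * walk_expectation ?\<mu> (\<lambda>x. exp (-\<beta> * x)) (2*k) 0 0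
      \<le> exp (2 * real k * \<beta>\<^sup>2 - \<beta> * \<theta>)" by auto
  ultimately show ?thesis by linarith
qed

text \<open>Chebyshev: the final position has mean \<open>c = k * (r - s)\<close> and variance at
  most \<open>2 * k\<close>. Where \<open>\<bar>x\<bar> < \<theta>\<close>, it is at least
  \<open>\<bar>c\<bar> / 2\<close> away from \<open>c\<close>, which has probability at most
  \<open>8 * k / c\<^sup>2\<close>.\<close>

lemma walk_alternative_tail:
  assumes r: "\<bar>r\<bar> \<le> 1" and s: "\<bar>s\<bar> \<le> 1" and \<theta>: "2 * \<theta> \<le> real k * \<bar>r - s\<bar>" and k: "16 \<le> real k * (r - s)\<^sup>2"
  shows "walk_expectation (alternating_mean r s) (\<lambda>x. if \<bar>x\<bar> < \<theta> then 1 else 0) (2*k) 0 0 \<le> 1/2"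
proof -
  let ?\<mu> = "alternating_mean r s"
  define c where "c = real k * (r - s)"
  have \<mu>: "\<bar>?\<mu> t\<bar> \<le> 1" for t using abs_alternating_mean_le[OF r s] .
  have absc: "\<bar>c\<bar> = real k * \<bar>r - s\<bar>" by (simp add: c_def abs_mult)
  have k0: "0 < real k" using k by (cases k) auto
  have c2: "c\<^sup>2 = real k * (real k * (r - s)\<^sup>2)" by (simp add: c_def power_mult_distrib power2_eq_square)
  then have c16: "16 * real k \<le> c\<^sup>2" using k k0 by simp
  have c0: "0 < c\<^sup>2" using c16 k0 by linarith
  have pt: "(if \<bar>x\<bar> < \<theta> then 1 else 0) \<le> 0 + (4 / c\<^sup>2) * (x - c)\<^sup>2 + 0 * (0::real)" for x
  proof (cases "\<bar>x\<bar> < \<theta>")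
    case True
    then have "\<bar>c\<bar> / 2 \<le> \<bar>x - c\<bar>" using \<theta> absc by linarith
    then have "(\<bar>c\<bar> / 2)\<^sup>2 \<le> (x - c)\<^sup>2" by (metis abs_ge_zero abs_le_square_iff abs_of_nonneg divide_nonneg_nonneg zero_le_numeral)
    then show ?thesis using True c0 by (simp add: field_simps)
  qed simp
  have "walk_expectation ?\<mu> (\<lambda>x. if \<bar>x\<bar> < \<theta> then 1 else 0) (2*k) 0 0
      \<le> walk_expectation ?\<mu> (\<lambda>x. 0 + (4 / c\<^sup>2) * (x - c)\<^sup>2 + 0 * 0) (2*k) 0 0"
    by (rule walk_expectation_mono[OF \<mu> pt])
  also have "\<dots> = (4 / c\<^sup>2) * walk_expectation ?\<mu> (\<lambda>x. (x - c)\<^sup>2) (2*k) 0 0"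
    unfolding walk_expectation_linear by simp
  also have "\<dots> \<le> (4 / c\<^sup>2) * real (2*k)"
    using walk_expectation_square[of ?\<mu> c "2*k" 0 0, OF \<mu>] c0
    by (intro mult_left_mono) (auto simp: sum_alternating_mean c_def[symmetric])
  also have "\<dots> \<le> 1/2" using c16 c0 by (simp add: field_simps)
  finally show ?thesis .
qed

section \<open>Upper bound\<close>

text \<open>Outcomes on \<open>\<sigma>\<close> are negated, so the walk estimates the difference of
  the two Pauli coefficients.\<close>

definition history_walk :: "history \<Rightarrow> real" where
  "history_walk h = (\<Sum>(c, s, b)\<leftarrow>h. if c = b then 1 else -1)"

lemma history_walk_simps [simp]:
  "history_walk [] = 0"
  "history_walk [(c, s, b)] = (if c = b then 1 else -1)"
  "history_walk (h @ [(c, s, b)]) = history_walk h + (if c = b then 1 else -1)"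
  by (simp_all add: history_walk_def)

text \<open>The identity string is a junk value for histories that cannot occur: validity is demanded
  for every history.\<close>

definition block_string :: "nat \<Rightarrow> history \<Rightarrow> nat list" where
  "block_string n h = (if fst (snd (hd h)) \<in> pauli_strings n then fst (snd (hd h)) else replicate n 0)"

text \<open>A tester has no memory besides the history, so the random string is recovered from the
  first entry and the parity of the length says which state is next.\<close>

definition block_tester :: "nat \<Rightarrow> real \<Rightarrow> tester" where
  "block_tester n \<theta> =
     (\<lambda>h q. if h = [] then (if fst q then 1 / 4^n else 0)
            else if q = (even (length h), block_string n h) then 1 else 0,
      \<lambda>h. if \<bar>history_walk h\<bar> < \<theta> then 1 else 0)"

lemma block_string_pauli_strings: "block_string n h \<in> pauli_strings n"
  by (simp add: block_string_def replicate_0_pauli_strings)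

lemma sum_queries: "(\<Sum>q\<in>queries n. f q) = (\<Sum>s\<in>pauli_strings n. f (True, s) + f (False, s))"
proof -
  have "(\<Sum>q\<in>queries n. f q) = (\<Sum>c\<in>UNIV. \<Sum>s\<in>pauli_strings n. f (c, s))"
    unfolding queries_def by (simp add: sum.cartesian_product)
  then show ?thesis by (simp add: UNIV_bool sum.distrib add.commute)
qed

lemma valid_block_tester: "valid_tester n (block_tester n \<theta>)"
proof -
  have "(\<Sum>q\<in>queries n. fst (block_tester n \<theta>) h q) = 1" for h
  proof (cases "h = []")
    case True
    then show ?thesis by (simp add: block_tester_def sum_queries card_pauli_strings)
  next
    case False
    have "(even (length h), block_string n h) \<in> queries n"
      using block_string_pauli_strings by (simp add: queries_def)
    then show ?thesis using False by (simp add: block_tester_def)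
  qed
  then show ?thesis by (auto simp: valid_tester_def block_tester_def)
qed

text \<open>Once the first entry fixes the string, the queries are deterministic and the outcomes
  are the steps of the walk.\<close>

lemma accept_prob_block_tester_run:
  assumes \<rho>: "density_matrix n \<rho>" and \<sigma>: "density_matrix n \<sigma>"
    and h: "h \<noteq> []" "fst (snd (hd h)) = s" "s \<in> pauli_strings n"
  shows "accept_prob n (block_tester n \<theta>) \<rho> \<sigma> k h
       = walk_expectation (alternating_mean (pauli_coeff n \<rho> s) (pauli_coeff n \<sigma> s))
           (\<lambda>x. if \<bar>x\<bar> < \<theta> then 1 else 0) k (length h) (history_walk h)"
  using h
proof (induction k arbitrary: h)
  case 0
  then show ?case by (simp add: block_tester_def)
next
  case (Suc k)
  let ?c = "even (length h)"
  let ?f = "\<lambda>b. accept_prob n (block_tester n \<theta>) \<rho> \<sigma> k (h @ [(?c, s, b)])"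
  have bs: "block_string n h = s" using Suc.prems by (simp add: block_string_def)
  have mem: "(?c, s) \<in> queries n" using Suc.prems by (simp add: queries_def)
  have "accept_prob n (block_tester n \<theta>) \<rho> \<sigma> (Suc k) h
      = (\<Sum>q\<in>queries n. if q = (?c, s) then
          (\<Sum>b\<in>UNIV. pauli_outcome_prob n (if ?c then \<rho> else \<sigma>) s b * ?f b) else 0)"
    unfolding accept_prob.simps using Suc.prems(1)
    by (intro sum.cong refl) (auto simp: block_tester_def bs)
  also have "\<dots> = pauli_outcome_prob n (if ?c then \<rho> else \<sigma>) s True * ?f True
      + pauli_outcome_prob n (if ?c then \<rho> else \<sigma>) s False * ?f False"
    using mem by (simp add: UNIV_bool add.commute)
  finally show ?case
    using Suc.prems
    by (simp add: Suc.IH pauli_outcome_prob_eq density_matrixD(1,2)[OF \<rho>] density_matrixD(1,2)[OF \<sigma>]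
        alternating_mean_def add.commute)
qed

definition block_accept :: "nat \<Rightarrow> nat \<Rightarrow> real \<Rightarrow> complex mat \<Rightarrow> complex mat \<Rightarrow> real" where
  "block_accept n k \<theta> \<rho> \<sigma> = (\<Sum>s\<in>pauli_strings n.
     walk_expectation (alternating_mean (pauli_coeff n \<rho> s) (pauli_coeff n \<sigma> s))
       (\<lambda>x. if \<bar>x\<bar> < \<theta> then 1 else 0) (2*k) 0 0) / 4^n"

lemma accept_prob_block_tester:
  assumes \<rho>: "density_matrix n \<rho>" and \<sigma>: "density_matrix n \<sigma>" and "0 < k"
  shows "accept_prob n (block_tester n \<theta>) \<rho> \<sigma> (2*k) [] = block_accept n k \<theta> \<rho> \<sigma>"
proof -
  obtain m where m: "2 * k = Suc m" using \<open>0 < k\<close> by (cases "2*k") auto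
  show ?thesis
    unfolding m accept_prob.simps sum_queries block_accept_def sum_divide_distrib
  proof (intro sum.cong refl)
    fix s assume s: "s \<in> pauli_strings n"
    have first: "fst (block_tester n \<theta>) [] (c, s) = (if c then 1 / 4^n else 0)" for c
      by (simp add: block_tester_def)
    have mean: "alternating_mean r r' 0 = r" for r r' by (simp add: alternating_mean_def)
    show "fst (block_tester n \<theta>) [] (True, s) * (\<Sum>b\<in>UNIV.
            pauli_outcome_prob n (if fst (True, s) then \<rho> else \<sigma>) (snd (True, s)) b *
            accept_prob n (block_tester n \<theta>) \<rho> \<sigma> m ([] @ [(fst (True, s), snd (True, s), b)]))
        + fst (block_tester n \<theta>) [] (False, s) * (\<Sum>b\<in>UNIV.
            pauli_outcome_prob n (if fst (False, s) then \<rho> else \<sigma>) (snd (False, s)) b *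
            accept_prob n (block_tester n \<theta>) \<rho> \<sigma> m ([] @ [(fst (False, s), snd (False, s), b)]))
        = walk_expectation (alternating_mean (pauli_coeff n \<rho> s) (pauli_coeff n \<sigma> s))
            (\<lambda>x. if \<bar>x\<bar> < \<theta> then 1 else 0) (Suc m) 0 0 / 4^n"
      using s by (simp add: first mean UNIV_bool accept_prob_block_tester_run[OF \<rho> \<sigma>]
          pauli_outcome_prob_eq density_matrixD(1,2)[OF \<rho>] add.commute)
  qed
qed

section \<open>Conjunctions of independent testers\<close>

text \<open>Hides a tester behind its acceptance function, so that combining testers becomes
  multiplying functions.\<close>

definition implementable :: "nat \<Rightarrow> nat \<Rightarrow> (complex mat \<Rightarrow> complex mat \<Rightarrow> real) \<Rightarrow> bool" where
  "implementable n m f \<longleftrightarrow> (\<exists>T. valid_tester n T \<and>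
     (\<forall>\<rho> \<sigma>. density_matrix n \<rho> \<longrightarrow> density_matrix n \<sigma> \<longrightarrow> accept_prob n T \<rho> \<sigma> m [] = f \<rho> \<sigma>))"

lemma implementable_block_accept: "0 < k \<Longrightarrow> implementable n (2*k) (block_accept n k \<theta>)"
  unfolding implementable_def using valid_block_tester accept_prob_block_tester by blast

text \<open>\<open>U\<close> sees only its own part of the history; on fresh copies the two runs are
  therefore independent.\<close>

definition and_tester :: "nat \<Rightarrow> tester \<Rightarrow> tester \<Rightarrow> tester" where
  "and_tester m T U =
     (\<lambda>h. if length h < m then fst T h else fst U (drop m h),
      \<lambda>h. snd T (take m h) * snd U (drop m h))"

lemma accept_prob_and_tester_snd:
  "length h = m \<Longrightarrow>
   accept_prob n (and_tester m T U) \<rho> \<sigma> k (h @ h') = snd T h * accept_prob n U \<rho> \<sigma> k h'"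
proof (induction k arbitrary: h')
  case (Suc k)
  have "fst (and_tester m T U) (h @ h') = fst U h'" using Suc.prems by (simp add: and_tester_def)
  then show ?case using Suc by (simp add: sum_distrib_left mult_ac)
qed (simp add: and_tester_def)

text \<open>\<open>U\<close> starts from the empty history whatever \<open>T\<close> has seen, so
  its acceptance probability is a constant factor throughout the first phase.\<close>

lemma accept_prob_and_tester_fst:
  "length h + k = m \<Longrightarrow>
   accept_prob n (and_tester m T U) \<rho> \<sigma> (k + l) h = accept_prob n T \<rho> \<sigma> k h * accept_prob n U \<rho> \<sigma> l []"
proof (induction k arbitrary: h)
  case 0
  then show ?case using accept_prob_and_tester_snd[of h m n T U \<rho> \<sigma> l "[]"] by simp
next
  case (Suc k)
  have "fst (and_tester m T U) h = fst T h" using Suc.prems by (simp add: and_tester_def)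
  then show ?case using Suc by (simp add: sum_distrib_right sum_distrib_left mult_ac)
qed

lemma implementable_mult:
  assumes "implementable n m f" "implementable n l g"
  shows "implementable n (m + l) (\<lambda>\<rho> \<sigma>. f \<rho> \<sigma> * g \<rho> \<sigma>)"
proof -
  obtain T U where T: "valid_tester n T"
      "\<And>\<rho> \<sigma>. density_matrix n \<rho> \<Longrightarrow> density_matrix n \<sigma> \<Longrightarrow> accept_prob n T \<rho> \<sigma> m [] = f \<rho> \<sigma>"
    and U: "valid_tester n U"
      "\<And>\<rho> \<sigma>. density_matrix n \<rho> \<Longrightarrow> density_matrix n \<sigma> \<Longrightarrow> accept_prob n U \<rho> \<sigma> l [] = g \<rho> \<sigma>"
    using assms unfolding implementable_def by blast
  have "valid_tester n (and_tester m T U)"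
    using T(1) U(1) by (auto simp: valid_tester_def and_tester_def mult_le_one)
  moreover have "accept_prob n (and_tester m T U) \<rho> \<sigma> (m + l) [] = f \<rho> \<sigma> * g \<rho> \<sigma>"
    if "density_matrix n \<rho>" "density_matrix n \<sigma>" for \<rho> \<sigma>
    using accept_prob_and_tester_fst[of "[]" m m] T(2) U(2) that by simp
  ultimately show ?thesis unfolding implementable_def by blast
qed

text \<open>Base case of the products below; \<open>block_tester\<close> only lends a valid query
  rule.\<close>

lemma implementable_1: "implementable n 0 (\<lambda>\<rho> \<sigma>. 1)"
proof -
  have "valid_tester n (fst (block_tester n 0), \<lambda>h. 1)"
    using valid_block_tester[of n 0] by (simp add: valid_tester_def)
  then show ?thesis unfolding implementable_def by fastforce
qed

lemma implementable_power:
  "implementable n m f \<Longrightarrow> implementable n (R * m) (\<lambda>\<rho> \<sigma>. f \<rho> \<sigma> ^ R)"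
proof (induction R)
  case (Suc R)
  then show ?case using implementable_mult[of n m f "R * m" "\<lambda>\<rho> \<sigma>. f \<rho> \<sigma> ^ R"] by simp
qed (simp add: implementable_1)

lemma implementable_prod:
  fixes J :: nat
  shows "(\<And>j. j < J \<Longrightarrow> implementable n (m j) (f j)) \<Longrightarrow>
   implementable n (\<Sum>j<J. m j) (\<lambda>\<rho> \<sigma>. \<Prod>j<J. f j \<rho> \<sigma>)"
proof (induction J)
  case (Suc J)
  then show ?case
    using implementable_mult[of n "\<Sum>j<J. m j" "\<lambda>\<rho> \<sigma>. \<Prod>j<J. f j \<rho> \<sigma>" "m J" "f J"] by simp
qed (simp add: implementable_1)

section \<open>Acceptance probability of a block\<close>

lemma block_accept_bounds:
  assumes \<rho>: "density_matrix n \<rho>" and \<sigma>: "density_matrix n \<sigma>"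
  shows "0 \<le> block_accept n k \<theta> \<rho> \<sigma>" "block_accept n k \<theta> \<rho> \<sigma> \<le> 1"
proof -
  let ?W = "\<lambda>s. walk_expectation (alternating_mean (pauli_coeff n \<rho> s) (pauli_coeff n \<sigma> s))
       (\<lambda>x. if \<bar>x\<bar> < \<theta> then 1 else 0) (2*k) 0 0"
  have W: "0 \<le> ?W s" "?W s \<le> 1" for s
    using abs_pauli_coeff_le_1 \<rho> \<sigma> by (auto intro!: walk_expectation_indicator_bounds abs_alternating_mean_le)
  show "0 \<le> block_accept n k \<theta> \<rho> \<sigma>" unfolding block_accept_def using W by (simp add: sum_nonneg)
  have "(\<Sum>s\<in>pauli_strings n. ?W s) \<le> (\<Sum>s\<in>pauli_strings n. 1)" using W by (intro sum_mono) auto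
  then show "block_accept n k \<theta> \<rho> \<sigma> \<le> 1"
    unfolding block_accept_def by (simp add: card_pauli_strings)
qed

lemma block_accept_null:
  assumes \<rho>: "density_matrix n \<rho>" and \<beta>: "0 \<le> \<beta>" "\<beta> \<le> 1"
  shows "block_accept n k \<theta> \<rho> \<rho> \<ge> 1 - 2 * exp (2 * real k * \<beta>\<^sup>2 - \<beta> * \<theta>)"
proof -
  have "(\<Sum>s\<in>pauli_strings n. 1 - 2 * exp (2 * real k * \<beta>\<^sup>2 - \<beta> * \<theta>)) \<le> (\<Sum>s\<in>pauli_strings n.
     walk_expectation (alternating_mean (pauli_coeff n \<rho> s) (pauli_coeff n \<rho> s))
       (\<lambda>x. if \<bar>x\<bar> < \<theta> then 1 else 0) (2*k) 0 0)"
    by (intro sum_mono walk_null_tail abs_pauli_coeff_le_1[OF \<rho>] \<beta>)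
  then show ?thesis by (simp add: block_accept_def card_pauli_strings field_simps)
qed

text \<open>By \<open>walk_alternative_tail\<close> each string with a large difference lowers the
  average over the strings by half its share.\<close>

lemma block_accept_alternative:
  assumes \<rho>: "density_matrix n \<rho>" and \<sigma>: "density_matrix n \<sigma>"
    and \<tau>: "0 \<le> \<tau>" "16 \<le> real k * \<tau>" "2 * \<theta> \<le> real k * sqrt \<tau>"
  shows "block_accept n k \<theta> \<rho> \<sigma>
       \<le> 1 - real (card {s \<in> pauli_strings n. \<tau> \<le> (pauli_coeff n \<rho> s - pauli_coeff n \<sigma> s)\<^sup>2}) / (2 * 4^n)"
proof -
  let ?W = "\<lambda>s. walk_expectation (alternating_mean (pauli_coeff n \<rho> s) (pauli_coeff n \<sigma> s))
       (\<lambda>x. if \<bar>x\<bar> < \<theta> then 1 else 0) (2*k) 0 0"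
  let ?d = "\<lambda>s. pauli_coeff n \<rho> s - pauli_coeff n \<sigma> s"
  have "?W s \<le> 1 - (if \<tau> \<le> (?d s)\<^sup>2 then 1/2 else 0)" for s
  proof (cases "\<tau> \<le> (?d s)\<^sup>2")
    case True
    have "sqrt \<tau> \<le> \<bar>?d s\<bar>" using True real_sqrt_le_mono by fastforce
    then have "real k * sqrt \<tau> \<le> real k * \<bar>?d s\<bar>" "real k * \<tau> \<le> real k * (?d s)\<^sup>2"
      using True by (auto intro!: mult_left_mono)
    then have "?W s \<le> 1/2"
      using \<tau> by (intro walk_alternative_tail abs_pauli_coeff_le_1 \<rho> \<sigma>) auto
    then show ?thesis using True by simp
  next
    case False
    have "?W s \<le> 1"
      using abs_pauli_coeff_le_1 \<rho> \<sigma> by (auto intro!: walk_expectation_indicator_bounds abs_alternating_mean_le)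
    then show ?thesis using False by simp
  qed
  then have "(\<Sum>s\<in>pauli_strings n. ?W s) \<le> (\<Sum>s\<in>pauli_strings n. 1 - (if \<tau> \<le> (?d s)\<^sup>2 then 1/2 else 0))"
    by (intro sum_mono)
  also have "\<dots> = 4^n - real (card {s \<in> pauli_strings n. \<tau> \<le> (?d s)\<^sup>2}) / 2"
    by (simp add: sum_subtractf card_pauli_strings sum.If_cases Int_def)
  finally have "block_accept n k \<theta> \<rho> \<sigma> \<le> (4^n - real (card {s \<in> pauli_strings n. \<tau> \<le> (?d s)\<^sup>2}) / 2) / 4^n"
    unfolding block_accept_def by (intro divide_right_mono) auto
  then show ?thesis by (simp add: diff_divide_distrib)
qed

text \<open>Dyadic bucketing of the coordinates by size; the coordinates below the last level
  carry at most half of the total weight.\<close>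

lemma exists_heavy_level:
  fixes w :: "'a \<Rightarrow> real"
  assumes fin: "finite S" "card S \<le> 2^L" and L: "0 < L" and e: "0 < e" and sum: "e < (\<Sum>s\<in>S. w s)"
  shows "\<exists>j\<le>L. 2^j / (2 * real L) \<le> real (card {s \<in> S. e / 2^(Suc j) \<le> w s})"
proof (cases "\<exists>s\<in>S. e / 2 \<le> w s")
  case True
  \<comment> \<open>At level 0 a single coordinate suffices, as
    \<open>1 / (2 * L) \<le> 1\<close>.\<close>
  then have "card {s \<in> S. e / 2^(Suc 0) \<le> w s} \<noteq> 0" using fin by auto
  then have "1 \<le> real (card {s \<in> S. e / 2^(Suc 0) \<le> w s})" by linarith
  moreover have "2^0 / (2 * real L) \<le> 1" using L by simp
  ultimately show ?thesis by (intro exI[of _ 0]) linarith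
next
  case False
  show ?thesis
  proof (rule ccontr)
    assume "\<not> ?thesis"
    then have light: "real (card {s \<in> S. e / 2^(Suc j) \<le> w s}) < 2^j / (2 * real L)" if "j \<le> L" for j
      using that by (meson not_le)
    have cover: "w s \<le> e / 2^(Suc L) + (\<Sum>j\<in>{1..L}. if e / 2^(Suc j) \<le> w s then e / 2^j else 0)"
      if "s \<in> S" for s
    proof (cases "e / 2^(Suc L) \<le> w s")
      case True
      \<comment> \<open>At its least level \<open>j\<close>, the coordinate misses level
        \<open>j - 1\<close> and is therefore below \<open>e / 2^j\<close>; level 0 is excluded by
        the case assumption.\<close>
      define j where "j = (LEAST j. e / 2^(Suc j) \<le> w s)"
      have j: "e / 2^(Suc j) \<le> w s" unfolding j_def using True by (rule LeastI)
      have "j \<noteq> 0"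
      proof
        assume "j = 0"
        then have "e / 2 \<le> w s" using j by simp
        then show False using \<open>\<not> (\<exists>s\<in>S. e / 2 \<le> w s)\<close> that by blast
      qed
      then obtain i where i: "j = Suc i" using not0_implies_Suc by blast
      have "w s \<le> e / 2^j"
        using not_less_Least[of i "\<lambda>j. e / 2^(Suc j) \<le> w s"] i unfolding j_def[symmetric] by simp
      moreover have "j \<le> L" unfolding j_def using True by (rule Least_le)
      have "(if e / 2^(Suc j) \<le> w s then e / 2^j else 0) \<le> (\<Sum>j\<in>{1..L}. if e / 2^(Suc j) \<le> w s then e / 2^j else 0)"
        using i \<open>j \<le> L\<close> e by (intro member_le_sum) auto
      ultimately show ?thesis using j e by (simp add: add_increasing)
    next
      case False
      have "0 \<le> (\<Sum>j\<in>{1..L}. if e / 2^(Suc j) \<le> w s then e / 2^j else 0)"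
        using e by (intro sum_nonneg) auto
      then show ?thesis using False by linarith
    qed
    have "(\<Sum>s\<in>S. w s) \<le> (\<Sum>s\<in>S. e / 2^(Suc L) + (\<Sum>j\<in>{1..L}. if e / 2^(Suc j) \<le> w s then e / 2^j else 0))"
      by (intro sum_mono cover)
    also have "\<dots> = real (card S) * (e / 2^(Suc L))
        + (\<Sum>j\<in>{1..L}. \<Sum>s\<in>S. if e / 2^(Suc j) \<le> w s then e / 2^j else 0)"
      by (subst sum.swap) (simp add: sum.distrib)
    also have "\<dots> = real (card S) * (e / 2^(Suc L))
        + (\<Sum>j\<in>{1..L}. real (card {s \<in> S. e / 2^(Suc j) \<le> w s}) * (e / 2^j))"
      using fin by (simp add: sum.If_cases Int_def)
    \<comment> \<open>The remainder is at most \<open>e / 2\<close>, and each of the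
      \<open>L\<close> levels contributes at most \<open>e / (2 * L)\<close>.\<close>
    also have "\<dots> \<le> real (2^L) * (e / 2^(Suc L)) + (\<Sum>j\<in>{1..L}. 2^j / (2 * real L) * (e / 2^j))"
      using e fin(2) less_imp_le[OF light]
      by (intro add_mono sum_mono mult_right_mono) (auto simp del: of_nat_power)
    also have "\<dots> = e" using L by simp
    finally show False using sum by simp
  qed
qed

section \<open>Parameters of the combined tester\<close>

text \<open>Failure probability of all blocks together, under a union bound. The exponent is 13 = 9
  + 2 + 2, from \<open>288 \<le> 2^9\<close>, \<open>n\<^sup>2 \<le> 4^n\<close> and the factor
  \<open>4^n\<close>.\<close>

lemma exp_13_bound:
  assumes "n \<ge> 1"
  shows "48 * (real n)\<^sup>2 * 4^n * (2 * exp (- (13 * real n))) \<le> 1/3"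
proof -
  have "real n \<le> 2^n" using of_nat_less_two_power[of n, where 'a = real] by simp
  then have "(real n)\<^sup>2 \<le> (2^n)\<^sup>2" by (intro power_mono) auto
  also have "(2^n)\<^sup>2 = (4::real)^n" by (simp add: power2_eq_square power_mult_distrib[symmetric])
  finally have n2: "(real n)\<^sup>2 \<le> 4^n" .
  have "(288::real) \<le> 512^1" by simp
  also have "\<dots> \<le> 512^n" using assms by (intro power_increasing) auto
  finally have c: "(288::real) \<le> 512^n" .
  have "288 * (real n)\<^sup>2 * 4^n \<le> 512^n * 4^n * (4::real)^n"
    using n2 c by (intro mult_mono) auto
  also have "\<dots> = (2^13)^n" by (simp add: power_mult_distrib[symmetric])
  also have "\<dots> \<le> (exp 1 ^ 13)^n"
    using exp_ge_add_one_self[of 1] by (intro power_mono) auto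
  also have "\<dots> = exp (13 * real n)"
    by (simp add: power_mult[symmetric] exp_of_nat_mult[symmetric] mult.commute)
  finally show ?thesis by (simp add: exp_minus field_simps)
qed

lemma pow2_level: "j \<le> 2 * n \<Longrightarrow> 2^(2 * n - j) * 2^j = (4::real)^n"
  by (simp add: power_add[symmetric] power_mult)

theorem pauli_closeness_upper_bound:
  assumes n: "n \<ge> 1" and \<epsilon>: "0 < \<epsilon>" "\<epsilon> \<le> 1"
  shows "\<exists>m T. real m \<le> 80064 * real n ^ 4 * 4^n / \<epsilon>\<^sup>2 \<and> pauli_closeness_tester n \<epsilon> m T"
proof -
  \<comment> \<open>416 = 32 * 13: the Chernoff exponent below is \<open>- k * \<tau> / 32\<close>
    and has to reach \<open>- 13 * n\<close>.\<close>
  define B where "B = nat \<lceil>416 * real n / \<epsilon>\<^sup>2\<rceil>"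
  \<comment> \<open>Chosen so that \<open>k j * \<tau> j\<close> is the same at every level.\<close>
  define k where "k j = 2^(Suc j) * B" for j
  define \<tau> where "\<tau> j = \<epsilon>\<^sup>2 / 2^(Suc j)" for j :: nat
  \<comment> \<open>Half of the drift at the smallest difference that counts as large.\<close>
  define \<theta> where "\<theta> j = real (k j) * sqrt (\<tau> j) / 2" for j
  \<comment> \<open>One block at a heavy level \<open>j\<close> rejects with probability at least
    \<open>2^j / (8 * n * 4^n)\<close>; \<open>R j\<close> repetitions bring the sum of these to
    2.\<close>
  define R where "R j = 16 * n * 2^(2*n - j)" for j
  define J where "J = 2 * n + 1"
  define f where "f \<rho> \<sigma> = (\<Prod>j<J. block_accept n (k j) (\<theta> j) \<rho> \<sigma> ^ R j)" for \<rho> \<sigma>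
  define m where "m = (\<Sum>j<J. R j * (2 * k j))"
  have \<epsilon>2: "0 < \<epsilon>\<^sup>2" "\<epsilon>\<^sup>2 \<le> 1" using \<epsilon> by (auto simp: power_le_one)
  have B: "416 * real n / \<epsilon>\<^sup>2 \<le> real B" "real B \<le> 417 * real n / \<epsilon>\<^sup>2"
  proof -
    have nn: "0 \<le> 416 * real n / \<epsilon>\<^sup>2" using \<epsilon>2 by simp
    show "416 * real n / \<epsilon>\<^sup>2 \<le> real B" unfolding B_def using nn by linarith
    have "real B \<le> 416 * real n / \<epsilon>\<^sup>2 + 1" unfolding B_def using nn by linarith
    \<comment> \<open>The rounding error of the ceiling is absorbed by raising 416 to 417.\<close>
    moreover have "1 \<le> real n / \<epsilon>\<^sup>2" using n \<epsilon>2 by (simp add: field_simps)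
    ultimately show "real B \<le> 417 * real n / \<epsilon>\<^sup>2" by simp
  qed
  have B0: "0 < B"
  proof -
    have "0 < 416 * real n / \<epsilon>\<^sup>2" using n \<epsilon>2 by simp
    then show ?thesis using B(1) by linarith
  qed
  have k\<tau>: "real (k j) * \<tau> j = real B * \<epsilon>\<^sup>2" for j by (simp add: k_def \<tau>_def)
  have k\<tau>_ge: "416 * real n \<le> real (k j) * \<tau> j" for j
    unfolding k\<tau> using B(1) \<epsilon>2 by (simp add: field_simps)
  have \<tau>: "0 \<le> \<tau> j" "\<tau> j \<le> 1" for j
  proof -
    show "0 \<le> \<tau> j" using \<epsilon>2 by (simp add: \<tau>_def)
    have "\<epsilon>\<^sup>2 \<le> 2^Suc j" using \<epsilon>2 one_le_power[of "2::real" "Suc j"] by linarith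
    then show "\<tau> j \<le> 1" by (simp add: \<tau>_def)
  qed
  have "implementable n m f"
    unfolding m_def f_def k_def using B0
    by (intro implementable_prod implementable_power implementable_block_accept) auto
  then obtain T where T: "valid_tester n T"
    "\<And>\<rho> \<sigma>. density_matrix n \<rho> \<Longrightarrow> density_matrix n \<sigma> \<Longrightarrow> accept_prob n T \<rho> \<sigma> m [] = f \<rho> \<sigma>"
    unfolding implementable_def by blast
  have count: "real m \<le> 80064 * real n ^ 4 * 4^n / \<epsilon>\<^sup>2"
  proof -
    \<comment> \<open>Every level costs \<open>64 * n * 4^n * B\<close> copies, and 3 * 64 * 417 =
      80064.\<close>
    have "real m = (\<Sum>j<J. 64 * real n * (2^(2*n - j) * 2^j) * real B)"
      by (simp add: m_def R_def k_def mult_ac)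
    also have "\<dots> = (\<Sum>j<J. 64 * real n * 4^n * real B)"
      by (intro sum.cong refl, subst pow2_level) (auto simp: J_def)
    also have "\<dots> = (2 * real n + 1) * (64 * real n * 4^n * real B)" by (simp add: J_def add.commute)
    also have "\<dots> \<le> (3 * real n) * (64 * real n * 4^n * (417 * real n / \<epsilon>\<^sup>2))"
      using n B(2) by (intro mult_mono) auto
    also have "\<dots> = 80064 * 4^n / \<epsilon>\<^sup>2 * real n ^ 3" by (simp add: power3_eq_cube)
    also have "\<dots> \<le> 80064 * 4^n / \<epsilon>\<^sup>2 * real n ^ 4"
      using n by (intro mult_left_mono power_increasing) auto
    finally show ?thesis by (simp add: mult_ac)
  qed
  have null: "2/3 \<le> f \<rho> \<rho>" if \<rho>: "density_matrix n \<rho>" for \<rho>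
  proof -
    define \<eta> where "\<eta> = 2 * exp (- (13 * real n))"
    have \<eta>: "0 \<le> \<eta>" "\<eta> \<le> 1"
    proof -
      show "0 \<le> \<eta>" by (simp add: \<eta>_def)
      have "2 \<le> exp (13 * real n)" using exp_ge_add_one_self[of "13 * real n"] n by linarith
      then show "\<eta> \<le> 1" by (simp add: \<eta>_def exp_minus field_simps)
    qed
    have blk: "1 - \<eta> \<le> block_accept n (k j) (\<theta> j) \<rho> \<rho>" for j
    proof -
      \<comment> \<open>The minimiser \<open>\<theta> / (4 * k)\<close> of the Chernoff
        exponent.\<close>
      let ?\<beta> = "sqrt (\<tau> j) / 8"
      have "2 * real (k j) * ?\<beta>\<^sup>2 - ?\<beta> * \<theta> j = - (real (k j) * \<tau> j) / 32"
        using \<tau>[of j] by (simp add: \<theta>_def power_divide algebra_simps)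
      also have "\<dots> \<le> - (13 * real n)" using k\<tau>_ge[of j] by simp
      finally have "exp (2 * real (k j) * ?\<beta>\<^sup>2 - ?\<beta> * \<theta> j) \<le> exp (- (13 * real n))" by simp
      moreover have "1 - 2 * exp (2 * real (k j) * ?\<beta>\<^sup>2 - ?\<beta> * \<theta> j) \<le> block_accept n (k j) (\<theta> j) \<rho> \<rho>"
      proof (rule block_accept_null[OF \<rho>])
        have "sqrt (\<tau> j) \<le> 1" using \<tau>[of j] by simp
        then show "?\<beta> \<le> 1" by linarith
      qed (use \<tau>[of j] in simp)
      ultimately show ?thesis unfolding \<eta>_def by linarith
    qed
    have "(\<Sum>j<J. R j) \<le> (\<Sum>j<J. 16 * n * 2^(2*n))"
      unfolding R_def by (intro sum_mono mult_left_mono power_increasing) auto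
    also have "\<dots> = (2*n+1) * (16 * n * 4^n)" by (simp add: J_def power_mult)
    also have "\<dots> \<le> (3*n) * (16 * n * 4^n)" using n by (intro mult_right_mono) auto
    finally have "real (\<Sum>j<J. R j) \<le> real ((3*n) * (16 * n * 4^n))" by (simp only: of_nat_le_iff)
    then have "real (\<Sum>j<J. R j) \<le> 48 * (real n)\<^sup>2 * 4^n" by (simp add: power2_eq_square)
    then have "real (\<Sum>j<J. R j) * \<eta> \<le> 48 * (real n)\<^sup>2 * 4^n * \<eta>" using \<eta> by (intro mult_right_mono)
    also have "\<dots> \<le> 1/3" unfolding \<eta>_def by (rule exp_13_bound[OF n])
    finally have "2/3 \<le> 1 + real (\<Sum>j<J. R j) * (- \<eta>)" by simp
    \<comment> \<open>Bernoulli's inequality plays the role of the union bound.\<close>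
    also have "\<dots> \<le> (1 + (- \<eta>)) ^ (\<Sum>j<J. R j)" using \<eta> by (intro Bernoulli_inequality) auto
    also have "\<dots> = (\<Prod>j<J. (1 - \<eta>) ^ R j)" by (simp add: power_sum)
    also have "\<dots> \<le> f \<rho> \<rho>"
      unfolding f_def using \<eta> blk by (intro prod_mono conjI power_mono) auto
    finally show ?thesis .
  qed
  have alt: "f \<rho> \<sigma> \<le> 1/3"
    if \<rho>: "density_matrix n \<rho>" and \<sigma>: "density_matrix n \<sigma>" and far: "trace_norm (\<rho> - \<sigma>) > \<epsilon>" for \<rho> \<sigma>
  proof -
    let ?d = "\<lambda>s. (pauli_coeff n \<rho> s - pauli_coeff n \<sigma> s)\<^sup>2"
    have "\<epsilon>\<^sup>2 < (trace_norm (\<rho> - \<sigma>))\<^sup>2" using far \<epsilon> by (intro power_strict_mono) auto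
    also have "\<dots> \<le> (\<Sum>s\<in>pauli_strings n. ?d s)" by (rule trace_norm_diff_le_pauli_coeff[OF \<rho> \<sigma>])
    finally obtain j where j: "j \<le> 2*n"
      and heavy: "2^j / (2 * real (2*n)) \<le> real (card {s \<in> pauli_strings n. \<epsilon>\<^sup>2 / 2^(Suc j) \<le> ?d s})"
      using exists_heavy_level[of "pauli_strings n" "2*n" "\<epsilon>\<^sup>2" ?d] n \<epsilon>2
      by (auto simp: card_pauli_strings power_mult)
    let ?M = "real (card {s \<in> pauli_strings n. \<tau> j \<le> ?d s})"
    define x where "x = ?M / (2 * 4^n)"
    have b: "0 \<le> block_accept n (k i) (\<theta> i) \<rho> \<sigma>" "block_accept n (k i) (\<theta> i) \<rho> \<sigma> \<le> 1" for i
      by (rule block_accept_bounds[OF \<rho> \<sigma>])+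
    have "block_accept n (k j) (\<theta> j) \<rho> \<sigma> \<le> 1 - x"
      unfolding x_def using k\<tau>_ge[of j] n \<tau>[of j]
      by (intro block_accept_alternative[OF \<rho> \<sigma>]) (auto simp: \<theta>_def)
    also have "\<dots> \<le> exp (- x)" using exp_ge_add_one_self[of "- x"] by simp
    finally have "block_accept n (k j) (\<theta> j) \<rho> \<sigma> ^ R j \<le> exp (- x) ^ R j"
      using b by (intro power_mono)
    also have "\<dots> = exp (- (real (R j) * x))" by (simp add: exp_of_nat_mult[symmetric])
    also have "\<dots> \<le> exp (- 2)"
    proof -
      have "2 = real (R j) * (2^j / (2 * real (2*n)) / (2 * 4^n))"
        using pow2_level[OF j] n by (simp add: R_def field_simps)
      also have "\<dots> \<le> real (R j) * x"
        unfolding x_def \<tau>_def using heavy by (intro mult_left_mono divide_right_mono) auto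
      finally show ?thesis by simp
    qed
    also have "\<dots> \<le> 1/3" using exp_ge_add_one_self[of 2] by (simp add: exp_minus field_simps)
    finally have "block_accept n (k j) (\<theta> j) \<rho> \<sigma> ^ R j \<le> 1/3" .
    moreover have "f \<rho> \<sigma> = block_accept n (k j) (\<theta> j) \<rho> \<sigma> ^ R j
        * (\<Prod>i\<in>{..<J} - {j}. block_accept n (k i) (\<theta> i) \<rho> \<sigma> ^ R i)"
      unfolding f_def using j by (intro prod.remove) (auto simp: J_def)
    \<comment> \<open>The other blocks can only lower the acceptance probability, so one heavy level
      is enough.\<close>
    moreover have "\<dots> \<le> block_accept n (k j) (\<theta> j) \<rho> \<sigma> ^ R j * 1"
      using b by (intro mult_left_mono prod_le_1) (auto simp: power_le_one)
    ultimately show ?thesis by simp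
  qed
  have "pauli_closeness_tester n \<epsilon> m T"
    unfolding pauli_closeness_tester_def using T null alt by fastforce
  then show ?thesis using count by blast
qed

theorem mainTheorem1:
  shows "(\<exists>C>0. \<forall>n::nat. \<forall>\<epsilon>::real. n \<ge> 1 \<and> 0 < \<epsilon> \<and> \<epsilon> \<le> 1 \<longrightarrow>
            (\<exists>m T. real m \<le> C * real n ^ 4 * 4 ^ n / \<epsilon>\<^sup>2 \<and> pauli_closeness_tester n \<epsilon> m T))
       \<and> (\<exists>c>0. \<forall>n::nat. \<forall>\<epsilon>::real. \<forall>m T. n \<ge> 1 \<and> 0 < \<epsilon> \<and> \<epsilon> \<le> 1 \<and>
            pauli_closeness_tester n \<epsilon> m T \<longrightarrow> real m \<ge> c * 4 ^ n / \<epsilon>\<^sup>2)"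
proof (intro conjI)
  show "\<exists>C>0. \<forall>n::nat. \<forall>\<epsilon>::real. n \<ge> 1 \<and> 0 < \<epsilon> \<and> \<epsilon> \<le> 1 \<longrightarrow>
            (\<exists>m T. real m \<le> C * real n ^ 4 * 4 ^ n / \<epsilon>\<^sup>2 \<and> pauli_closeness_tester n \<epsilon> m T)"
    using pauli_closeness_upper_bound by (intro exI[of _ 80064]) auto
  show "\<exists>c>0. \<forall>n::nat. \<forall>\<epsilon>::real. \<forall>m T. n \<ge> 1 \<and> 0 < \<epsilon> \<and> \<epsilon> \<le> 1 \<and>
            pauli_closeness_tester n \<epsilon> m T \<longrightarrow> real m \<ge> c * 4 ^ n / \<epsilon>\<^sup>2"
    using pauli_closeness_lower_bound by (intro exI[of _ "1/8"] conjI allI impI) auto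
qed

end
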